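(* Let $a\in\mathbb{C}$ and let $\lambda\in\mathbb{C}$ with $|\lambda|\le 1$, $\lambda\neq 1$, and put $\varphi(w)=a+\lambda w$. Let $\psi\in F^2$ be such that $W_{\psi,\varphi}$ is a bounded operator on $F^2$ and $W_{\psi,\varphi}\neq 0$. Then $$\operatorname{dist}(W_{\psi,\varphi},\mathcal{T}):=\inf\{\|W_{\psi,\varphi}-A\| : A\in\mathcal{T}\}\ \ge\ \frac{1}{\|W_{\psi,\varphi}\|}\,\limsup_{|z|\to\infty} M_z(\psi,\varphi).$$
   Context: $\mu$ is the Gaussian measure $d\mu(z)=\frac1\pi e^{-|z|^2}dz$ on $\mathbb{C}$ ($dz$ is Lebesgue measure), and $F^2=L^2(\mathbb{C},\mu)\cap\operatorname{Hol}(\mathbb{C})$ is the Fock space of $\mu$-square integrable entire functions, a closed subspace of $L^2(\mathbb{C},\mu)$. Let $P$ be the orthogonal projection of $L^2(\mathbb{C},\mu)$ onto $F^2$; for $f\in L^\infty(\mathbb{C})$ the Toeplitz operator is $T_f g=P(fg)$, $g\in F^2$. The Toeplitz algebra $\mathcal{T}\subset\mathcal{L}(F^2)$ is the $C^*$-algebra generated by all $T_f$, $f\in L^\infty(\mathbb{C})$. Norms of operators are operator norms. For $\psi\in F^2$ and $\varphi$ entire, the weighted composition operator is $W_{\psi,\varphi}f=\psi\cdot(f\circ\varphi)$, and $M_z(\psi,\varphi):=|\psi(z)|^2e^{|\varphi(z)|^2-|z|^2}$ for $z\in\mathbb{C}$. *)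

theory Defs
  imports "HOL-Analysis.Analysis"
begin

definition gauss_measure :: "complex measure" where
  "gauss_measure = density lborel (\<lambda>z. ennreal (exp (- (cmod z)\<^sup>2) / pi))"

lemma sets_gauss_measure [simp, measurable_cong]: "sets gauss_measure = sets borel"
  by (simp add: gauss_measure_def)

lemma space_gauss_measure [simp]: "space gauss_measure = UNIV"
  by (simp add: gauss_measure_def)

definition fock_set :: "(complex \<Rightarrow> complex) set" where
  "fock_set = {f. f holomorphic_on UNIV \<and> integrable gauss_measure (\<lambda>z. (cmod (f z))\<^sup>2)}"

lemma fock_set_measurable:
  assumes "f \<in> fock_set" shows "f \<in> borel_measurable gauss_measure"
proof -
  have "continuous_on UNIV f"
    using assms by (auto simp: fock_set_def intro: holomorphic_on_imp_continuous_on)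
  then have "f \<in> borel_measurable borel"
    by (rule borel_measurable_continuous_onI)
  then show ?thesis by simp
qed

lemma fock_set_product_integrable:
  assumes "f \<in> fock_set" "g \<in> fock_set"
  shows "integrable gauss_measure (\<lambda>z. f z * cnj (g z))"
proof (rule Bochner_Integration.integrable_bound)
  show "integrable gauss_measure (\<lambda>z. (cmod (f z))\<^sup>2 + (cmod (g z))\<^sup>2)"
    using assms by (auto simp: fock_set_def)
  note [measurable] = fock_set_measurable[OF assms(1)] fock_set_measurable[OF assms(2)]
  have [measurable]: "cnj \<in> borel_measurable borel"
    by (intro borel_measurable_continuous_onI continuous_intros)
  show "(\<lambda>z. f z * cnj (g z)) \<in> borel_measurable gauss_measure"
    by measurable
  have "norm (f z * cnj (g z)) \<le> norm ((cmod (f z))\<^sup>2 + (cmod (g z))\<^sup>2)" for z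
  proof -
    have "0 \<le> (cmod (f z) - cmod (g z))\<^sup>2" by simp
    moreover have "0 \<le> cmod (f z) * cmod (g z)" by simp
    ultimately show ?thesis
      by (simp add: norm_mult power2_diff del: zero_le_power2 mult_nonneg_nonneg)
  qed
  then show "AE z in gauss_measure.
      norm (f z * cnj (g z)) \<le> norm ((cmod (f z))\<^sup>2 + (cmod (g z))\<^sup>2)"
    by simp
qed

lemma fock_set_zero: "(\<lambda>_. 0) \<in> fock_set"
  by (auto simp: fock_set_def)

lemma fock_set_mult:
  assumes "f \<in> fock_set" shows "(\<lambda>z. c * f z) \<in> fock_set"
  using assms by (auto simp: fock_set_def norm_mult power_mult_distrib intro: holomorphic_intros)

lemma fock_set_add:
  assumes "f \<in> fock_set" "g \<in> fock_set" shows "(\<lambda>z. f z + g z) \<in> fock_set"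
proof -
  have eq: "(cmod (f z + g z))\<^sup>2 =
      (cmod (f z))\<^sup>2 + (cmod (g z))\<^sup>2 + 2 * Re (f z * cnj (g z))" for z
    by (simp only: cmod_power2) (simp add: power2_eq_square algebra_simps)
  have "integrable gauss_measure
      (\<lambda>z. (cmod (f z))\<^sup>2 + (cmod (g z))\<^sup>2 + 2 * Re (f z * cnj (g z)))"
    using assms fock_set_product_integrable[OF assms]
    by (intro Bochner_Integration.integrable_add integrable_mult_right integrable_Re)
       (auto simp: fock_set_def)
  then show ?thesis
    using assms by (auto simp: fock_set_def eq intro: holomorphic_intros)
qed

typedef fock = fock_set morphisms fock_fun Abs_fock
  using fock_set_zero by blast

setup_lifting type_definition_fock

instantiation fock :: ab_group_add
begin
lift_definition zero_fock :: fock is "\<lambda>_. 0" by (rule fock_set_zero)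
lift_definition plus_fock :: "fock \<Rightarrow> fock \<Rightarrow> fock" is "\<lambda>f g z. f z + g z"
  by (rule fock_set_add)
lift_definition uminus_fock :: "fock \<Rightarrow> fock" is "\<lambda>f z. - f z"
  using fock_set_mult[where c = "-1"] by simp
lift_definition minus_fock :: "fock \<Rightarrow> fock \<Rightarrow> fock" is "\<lambda>f g z. f z - g z"
  using fock_set_add fock_set_mult[where c = "-1"] by fastforce
instance
  by standard (transfer; simp add: fun_eq_iff)+
end

lift_definition fock_scaleC :: "complex \<Rightarrow> fock \<Rightarrow> fock" is "\<lambda>c f z. c * f z"
  by (rule fock_set_mult)

text \<open>The complex inner product of \<open>F\<^sup>2\<close>, linear in the first argument.\<close>

definition fock_cinner :: "fock \<Rightarrow> fock \<Rightarrow> complex" where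
  "fock_cinner f g = (LINT z|gauss_measure. fock_fun f z * cnj (fock_fun g z))"

lemma fock_integrable:
  "integrable gauss_measure (\<lambda>z. fock_fun f z * cnj (fock_fun g z))"
  by (rule fock_set_product_integrable) (rule fock_fun)+

lemma fock_cinner_add_left: "fock_cinner (f + g) h = fock_cinner f h + fock_cinner g h"
  by (simp add: fock_cinner_def plus_fock.rep_eq distrib_right
      Bochner_Integration.integral_add fock_integrable)

lemma fock_cinner_scaleC_left: "fock_cinner (fock_scaleC c f) g = c * fock_cinner f g"
  by (simp add: fock_cinner_def fock_scaleC.rep_eq mult.assoc)

lemma fock_cinner_commute: "fock_cinner f g = cnj (fock_cinner g f)"
  unfolding fock_cinner_def
  by (subst Bochner_Integration.integral_cnj[symmetric]) (simp add: mult.commute)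

lemma fock_cinner_same:
  "fock_cinner f f = of_real (LINT z|gauss_measure. (cmod (fock_fun f z))\<^sup>2)"
  unfolding fock_cinner_def integral_complex_of_real[symmetric]
  by (simp add: complex_norm_square[symmetric])

lemma fock_cinner_eq_0:
  assumes "fock_cinner f f = 0" shows "f = 0"
proof -
  have int: "integrable gauss_measure (\<lambda>z. (cmod (fock_fun f z))\<^sup>2)"
    using fock_fun[of f] by (auto simp: fock_set_def)
  have "(LINT z|gauss_measure. (cmod (fock_fun f z))\<^sup>2) = 0"
    using assms by (simp add: fock_cinner_same)
  then have "AE z in gauss_measure. fock_fun f z = 0"
    using integral_nonneg_eq_0_iff_AE[OF int] by simp
  then have "AE z in lborel. fock_fun f z = 0"
    unfolding gauss_measure_def by (subst (asm) AE_density) auto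
  then have null: "{z. fock_fun f z \<noteq> 0} \<in> null_sets lebesgue"
    by (auto simp: eventually_ae_filter intro: null_sets_completion_subset null_sets_completionI)
  have "continuous_on UNIV (fock_fun f)"
    using fock_fun[of f] by (auto simp: fock_set_def intro: holomorphic_on_imp_continuous_on)
  then have "open {z. fock_fun f z \<noteq> 0}"
    by (intro open_Collect_neq continuous_intros)
  then have "{z. fock_fun f z \<noteq> 0} = {}"
    using null open_not_negligible negligible_iff_null_sets by blast
  then show ?thesis
    by (auto simp: fock_fun_inject[symmetric] zero_fock.rep_eq fun_eq_iff)
qed

instantiation fock :: real_inner
begin
definition scaleR_fock :: "real \<Rightarrow> fock \<Rightarrow> fock" where
  "scaleR_fock r = fock_scaleC (of_real r)"
definition inner_fock :: "fock \<Rightarrow> fock \<Rightarrow> real" where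
  "inner_fock f g = Re (fock_cinner f g)"
definition norm_fock :: "fock \<Rightarrow> real" where
  "norm_fock f = sqrt (inner f f)"
definition dist_fock :: "fock \<Rightarrow> fock \<Rightarrow> real" where
  "dist_fock f g = norm (f - g)"
definition sgn_fock :: "fock \<Rightarrow> fock" where
  "sgn_fock f = scaleR (inverse (norm f)) f"
definition uniformity_fock :: "(fock \<times> fock) filter" where
  "uniformity_fock = (INF e\<in>{0<..}. principal {(x, y). dist x y < e})"
definition open_fock :: "fock set \<Rightarrow> bool" where
  "open_fock U = (\<forall>x\<in>U. \<forall>\<^sub>F (x', y) in uniformity. x' = x \<longrightarrow> y \<in> U)"
instance
proof
  fix x y z :: fock and a b r :: real
  show "a *\<^sub>R (x + y) = a *\<^sub>R x + a *\<^sub>R y"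
    unfolding scaleR_fock_def by transfer (simp add: fun_eq_iff algebra_simps)
  show "(a + b) *\<^sub>R x = a *\<^sub>R x + b *\<^sub>R x"
    unfolding scaleR_fock_def by transfer (simp add: fun_eq_iff algebra_simps)
  show "a *\<^sub>R b *\<^sub>R x = (a * b) *\<^sub>R x"
    unfolding scaleR_fock_def by transfer (simp add: fun_eq_iff algebra_simps)
  show "1 *\<^sub>R x = x"
    unfolding scaleR_fock_def by transfer simp
  show "inner x y = inner y x"
    unfolding inner_fock_def by (subst fock_cinner_commute) simp
  show "inner (x + y) z = inner x z + inner y z"
    by (simp add: inner_fock_def fock_cinner_add_left)
  show "inner (r *\<^sub>R x) y = r * inner x y"
    by (simp add: inner_fock_def scaleR_fock_def fock_cinner_scaleC_left)
  show "0 \<le> inner x x"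
    by (simp add: inner_fock_def fock_cinner_same)
  show "inner x x = 0 \<longleftrightarrow> x = 0"
  proof
    assume "inner x x = 0"
    then have "fock_cinner x x = 0"
      by (simp add: inner_fock_def fock_cinner_same)
    then show "x = 0" by (rule fock_cinner_eq_0)
  next
    assume "x = 0"
    then show "inner x x = 0"
      by (simp add: inner_fock_def fock_cinner_def zero_fock.rep_eq)
  qed
qed (simp_all add: norm_fock_def dist_fock_def sgn_fock_def uniformity_fock_def open_fock_def)
end

lemma norm_fock_eq: "norm f = sqrt (LINT z|gauss_measure. (cmod (fock_fun f z))\<^sup>2)"
  by (simp add: norm_fock_def inner_fock_def fock_cinner_same)

text \<open>
  The bounded operators on \<open>F\<^sup>2\<close> are the complex linear elements of \<^typ>\<open>fock \<Rightarrow>\<^sub>L fock\<close>,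
  whose elements are a priori only real linear; the norm is the operator norm.
\<close>

definition fock_operators :: "(fock \<Rightarrow>\<^sub>L fock) set" where
  "fock_operators = {A. \<forall>c f. blinfun_apply A (fock_scaleC c f) = fock_scaleC c (blinfun_apply A f)}"

lemma norm_fock_scaleC: "norm (fock_scaleC c f) = cmod c * norm f"
  by (simp add: norm_fock_eq fock_scaleC.rep_eq norm_mult power_mult_distrib real_sqrt_mult)

lift_definition scalar_op :: "complex \<Rightarrow> fock \<Rightarrow>\<^sub>L fock" is fock_scaleC
proof (rule bounded_linear_intro)
  fix c r :: complex and s :: real and x y :: fock
  show "fock_scaleC c (x + y) = fock_scaleC c x + fock_scaleC c y"
    by transfer (simp add: fun_eq_iff algebra_simps)
  show "fock_scaleC c (s *\<^sub>R x) = s *\<^sub>R fock_scaleC c x"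
    unfolding scaleR_fock_def by transfer (simp add: fun_eq_iff algebra_simps)
  show "norm (fock_scaleC c x) \<le> norm x * cmod c"
    by (simp add: norm_fock_scaleC)
qed

definition is_adjoint :: "(fock \<Rightarrow>\<^sub>L fock) \<Rightarrow> (fock \<Rightarrow>\<^sub>L fock) \<Rightarrow> bool" where
  "is_adjoint A B \<longleftrightarrow>
     (\<forall>f g. fock_cinner (blinfun_apply A f) g = fock_cinner f (blinfun_apply B g))"

text \<open>
  Norm-closed *-subalgebras of the bounded operators on \<open>F\<^sup>2\<close>. The scalar multiple \<open>c A\<close> is
  written as the product of \<open>c I\<close> and \<open>A\<close>. Every bounded operator on the Hilbert space \<open>F\<^sup>2\<close>
  has exactly one adjoint, so the quantifier over \<open>B\<close> expresses closure under \<open>A \<mapsto> A\<^sup>*\<close>.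
\<close>

definition C_star_subalgebra :: "(fock \<Rightarrow>\<^sub>L fock) set \<Rightarrow> bool" where
  "C_star_subalgebra S \<longleftrightarrow>
     S \<subseteq> fock_operators \<and> closed S \<and> 0 \<in> S \<and>
     (\<forall>A\<in>S. \<forall>B\<in>S. A + B \<in> S \<and> A o\<^sub>L B \<in> S) \<and>
     (\<forall>A\<in>S. \<forall>c. scalar_op c o\<^sub>L A \<in> S) \<and>
     (\<forall>A\<in>S. \<forall>B. is_adjoint A B \<longrightarrow> B \<in> S)"

definition C_star_generated :: "(fock \<Rightarrow>\<^sub>L fock) set \<Rightarrow> (fock \<Rightarrow>\<^sub>L fock) set" where
  "C_star_generated X = \<Inter>{S. C_star_subalgebra S \<and> X \<subseteq> S}"

text \<open>
  Bounded symbols are taken Borel measurable; every class in \<open>L\<^sup>\<infinity>\<close> has a Borel representative.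
\<close>

definition L_infinity :: "(complex \<Rightarrow> complex) set" where
  "L_infinity = {f \<in> borel_measurable borel. \<exists>C. AE z in lborel. cmod (f z) \<le> C}"

text \<open>
  For \<open>u\<close> in \<open>L\<^sup>2\<close>, the orthogonal projection \<open>P u\<close> is the element \<open>h\<close> of \<open>F\<^sup>2\<close> with \<open>u - h\<close>
  orthogonal to \<open>F\<^sup>2\<close>; this is its graph.
\<close>

definition is_fock_projection :: "(complex \<Rightarrow> complex) \<Rightarrow> fock \<Rightarrow> bool" where
  "is_fock_projection u h \<longleftrightarrow>
     (\<forall>k. (LINT z|gauss_measure. (u z - fock_fun h z) * cnj (fock_fun k z)) = 0)"

definition is_toeplitz :: "(complex \<Rightarrow> complex) \<Rightarrow> (fock \<Rightarrow>\<^sub>L fock) \<Rightarrow> bool" where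
  "is_toeplitz f T \<longleftrightarrow>
     (\<forall>g. is_fock_projection (\<lambda>z. f z * fock_fun g z) (blinfun_apply T g))"

definition toeplitz_algebra :: "(fock \<Rightarrow>\<^sub>L fock) set" where
  "toeplitz_algebra = C_star_generated {T. \<exists>f\<in>L_infinity. is_toeplitz f T}"

definition weighted_comp ::
    "(complex \<Rightarrow> complex) \<Rightarrow> (complex \<Rightarrow> complex) \<Rightarrow> (complex \<Rightarrow> complex) \<Rightarrow> complex \<Rightarrow> complex" where
  "weighted_comp \<psi> \<phi> f = (\<lambda>z. \<psi> z * f (\<phi> z))"

text \<open>
  \<open>W\<close> is the weighted composition operator of \<open>\<psi>\<close> and \<open>\<phi>\<close>; such a \<open>W\<close> exists iff that operator
  maps \<open>F\<^sup>2\<close> boundedly into itself.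
\<close>

definition is_weighted_comp_op :: "fock \<Rightarrow> (complex \<Rightarrow> complex) \<Rightarrow> (fock \<Rightarrow>\<^sub>L fock) \<Rightarrow> bool" where
  "is_weighted_comp_op \<psi> \<phi> W \<longleftrightarrow>
     (\<forall>f. fock_fun (blinfun_apply W f) = weighted_comp (fock_fun \<psi>) \<phi> (fock_fun f))"

definition M_fun :: "(complex \<Rightarrow> complex) \<Rightarrow> (complex \<Rightarrow> complex) \<Rightarrow> complex \<Rightarrow> real" where
  "M_fun \<psi> \<phi> z = (cmod (\<psi> z))\<^sup>2 * exp ((cmod (\<phi> z))\<^sup>2 - (cmod z)\<^sup>2)"

end

theory Submission
  imports Defs "HOL-Probability.Distributions" "HOL-Complex_Analysis.Complex_Analysis"
begin

text \<open>
  Let \<open>W\<^sub>x\<close> be the Weyl operators and \<open>k\<^sub>z\<close> the normalized reproducing kernels. The operators \<open>A\<close> with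
  \<open>[W\<^sub>x, A] \<rightarrow> 0\<close> in norm as \<open>x \<rightarrow> 0\<close> form a \<open>C\<^sup>*\<close>-algebra. It contains the Toeplitz operators, because
  \<open>W\<^sub>x\<close> differs from multiplication by the unimodular function \<open>exp (2 i Im (u x\<^sup>*))\<close> by an operator
  from \<open>F\<^sup>2\<close> to \<open>L\<^sup>2\<close> of norm \<open>O(\<bar>x\<bar>)\<close>, and multiplication operators commute.
  On this algebra \<open>\<langle>A k\<^sub>w, k\<^sub>z\<rangle> \<rightarrow> 0\<close> as \<open>\<bar>z - w\<bar> \<rightarrow> \<infinity>\<close>. Since \<open>\<bar>\<phi>(z) - z\<bar> \<rightarrow> \<infinity>\<close> for \<open>\<lambda> \<noteq> 1\<close> and
  \<open>M\<^sub>z = \<bar>\<langle>W k\<^bsub>\<phi>(z)\<^esub>, k\<^sub>z\<rangle>\<bar>\<^sup>2\<close>, one gets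
  \<open>M\<^sub>z \<le> \<parallel>W\<parallel> (\<parallel>W - A\<parallel> + \<bar>\<langle>A k\<^bsub>\<phi>(z)\<^esub>, k\<^sub>z\<rangle>\<bar>)\<close> with last term tending to \<open>0\<close>.
\<close>

section \<open>Lebesgue and Gaussian measure on the plane\<close>

lemma measurable_Complex [measurable]:
  "(\<lambda>p::real \<times> real. Complex (fst p) (snd p)) \<in> borel_measurable borel"
proof -
  have "(\<lambda>p::real \<times> real. complex_of_real (fst p) + \<i> * complex_of_real (snd p)) \<in> borel_measurable borel"
    by (intro borel_measurable_continuous_onI continuous_intros)
  then show ?thesis by (simp add: Complex_eq)
qed

text \<open>Lebesgue measure is determined by its values on boxes, and a complex box pulls back to a
  real box of the same area. This opens the way to Tonelli in real and imaginary parts.\<close>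

lemma lborel_complex_eq_distr:
  "(lborel :: complex measure) = distr lborel borel (\<lambda>p. Complex (fst p) (snd p))"
proof (rule lborel_eqI)
  fix l u :: complex
  assume le: "\<And>b. b \<in> Basis \<Longrightarrow> l \<bullet> b \<le> u \<bullet> b"
  have "(\<lambda>p. Complex (fst p) (snd p)) -` box l u = box (Re l, Im l) (Re u, Im u)"
    by (auto simp: box_def Basis_complex_def Basis_prod_def)
  then have "emeasure (distr lborel borel (\<lambda>p. Complex (fst p) (snd p))) (box l u) =
      emeasure lborel (box (Re l, Im l) (Re u, Im u))"
    by (simp add: emeasure_distr)
  also have "\<dots> = (\<Prod>b\<in>Basis. (u - l) \<bullet> b)"
  proof -
    have "Re l \<le> Re u" "Im l \<le> Im u"
      using le[of 1] le[of \<i>] by (auto simp: Basis_complex_def)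
    then have "emeasure lborel (box (Re l, Im l) (Re u, Im u)) =
        ennreal (\<Prod>b\<in>Basis. ((Re u, Im u) - (Re l, Im l)) \<bullet> b)"
      by (intro emeasure_lborel_box) (auto simp: Basis_prod_def)
    also have "(\<Prod>b\<in>Basis. ((Re u, Im u) - (Re l, Im l)) \<bullet> b) = (\<Prod>b\<in>Basis. (u - l) \<bullet> b)"
      by (simp add: Basis_prod_def Basis_complex_def)
    finally show ?thesis .
  qed
  finally show "emeasure (distr lborel borel (\<lambda>p. Complex (fst p) (snd p))) (box l u) =
      (\<Prod>b\<in>Basis. (u - l) \<bullet> b)" .
qed simp

text \<open>Both orders of integration are kept because a shear is treated by integrating first over
  the coordinate that it translates.\<close>

lemma nn_integral_lborel_complex:
  assumes [measurable]: "f \<in> borel_measurable borel"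
  shows "(\<integral>\<^sup>+z. f z \<partial>lborel) = (\<integral>\<^sup>+x. \<integral>\<^sup>+y. f (Complex x y) \<partial>lborel \<partial>lborel)"
    and "(\<integral>\<^sup>+z. f z \<partial>lborel) = (\<integral>\<^sup>+y. \<integral>\<^sup>+x. f (Complex x y) \<partial>lborel \<partial>lborel)"
proof -
  have eq: "(\<integral>\<^sup>+z. f z \<partial>lborel) = (\<integral>\<^sup>+p. f (Complex (fst p) (snd p)) \<partial>(lborel \<Otimes>\<^sub>M lborel))"
    unfolding lborel_prod by (subst lborel_complex_eq_distr) (simp add: nn_integral_distr)
  have [measurable]: "(\<lambda>p. f (Complex (fst p) (snd p))) \<in> borel_measurable (borel \<Otimes>\<^sub>M borel)"
    unfolding borel_prod by measurable
  show "(\<integral>\<^sup>+z. f z \<partial>lborel) = (\<integral>\<^sup>+x. \<integral>\<^sup>+y. f (Complex x y) \<partial>lborel \<partial>lborel)"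
    unfolding eq by (subst lborel.nn_integral_fst[symmetric]) auto
  show "(\<integral>\<^sup>+z. f z \<partial>lborel) = (\<integral>\<^sup>+y. \<integral>\<^sup>+x. f (Complex x y) \<partial>lborel \<partial>lborel)"
    unfolding eq by (subst lborel_pair.nn_integral_snd[symmetric]) auto
qed

lemma nn_integral_lborel_shift:
  fixes f :: "'a::euclidean_space \<Rightarrow> ennreal"
  assumes [measurable]: "f \<in> borel_measurable borel"
  shows "(\<integral>\<^sup>+x. f (c + x) \<partial>lborel) = (\<integral>\<^sup>+x. f x \<partial>lborel)"
  by (subst (2) lborel_distr_plus[of c, symmetric]) (simp add: nn_integral_distr)

text \<open>For a fixed imaginary part the shear merely translates the real part.\<close>

lemma nn_integral_shear_Re:
  assumes [measurable]: "f \<in> borel_measurable borel"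
  shows "(\<integral>\<^sup>+z. f (z + of_real (t * Im z)) \<partial>lborel) = (\<integral>\<^sup>+z. f z \<partial>lborel)"
proof -
  have [measurable]: "(\<lambda>z. z + of_real (t * Im z)) \<in> borel_measurable borel"
    by (intro borel_measurable_continuous_onI continuous_intros)
  have [measurable]: "(\<lambda>x. f (Complex x y)) \<in> borel_measurable borel" for y
  proof -
    have "(\<lambda>x. Complex x y) \<in> borel_measurable borel"
      unfolding Complex_eq by (intro borel_measurable_continuous_onI continuous_intros)
    then show ?thesis by measurable
  qed
  have "(\<integral>\<^sup>+z. f (z + of_real (t * Im z)) \<partial>lborel) =
      (\<integral>\<^sup>+y. \<integral>\<^sup>+x. f (Complex (t * y + x) y) \<partial>lborel \<partial>lborel)"
    by (subst nn_integral_lborel_complex(2)) (simp_all add: Complex_eq algebra_simps)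
  also have "\<dots> = (\<integral>\<^sup>+y. \<integral>\<^sup>+x. f (Complex x y) \<partial>lborel \<partial>lborel)"
    by (intro nn_integral_cong nn_integral_lborel_shift[where f = "\<lambda>x. f (Complex x _)"]) measurable
  finally show ?thesis by (simp add: nn_integral_lborel_complex(2))
qed

lemma nn_integral_shear_Im:
  assumes [measurable]: "f \<in> borel_measurable borel"
  shows "(\<integral>\<^sup>+z. f (z + \<i> * of_real (t * Re z)) \<partial>lborel) = (\<integral>\<^sup>+z. f z \<partial>lborel)"
proof -
  have [measurable]: "(\<lambda>z. z + \<i> * of_real (t * Re z)) \<in> borel_measurable borel"
    by (intro borel_measurable_continuous_onI continuous_intros)
  have [measurable]: "(\<lambda>y. f (Complex x y)) \<in> borel_measurable borel" for x
  proof -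
    have "(\<lambda>y. Complex x y) \<in> borel_measurable borel"
      unfolding Complex_eq by (intro borel_measurable_continuous_onI continuous_intros)
    then show ?thesis by measurable
  qed
  have "(\<integral>\<^sup>+z. f (z + \<i> * of_real (t * Re z)) \<partial>lborel) =
      (\<integral>\<^sup>+x. \<integral>\<^sup>+y. f (Complex x (t * x + y)) \<partial>lborel \<partial>lborel)"
    by (subst nn_integral_lborel_complex(1)) (simp_all add: Complex_eq algebra_simps)
  also have "\<dots> = (\<integral>\<^sup>+x. \<integral>\<^sup>+y. f (Complex x y) \<partial>lborel \<partial>lborel)"
    by (intro nn_integral_cong nn_integral_lborel_shift[where f = "\<lambda>y. f (Complex _ y)"]) measurable
  finally show ?thesis by (simp add: nn_integral_lborel_complex(1))
qed

text \<open>A rotation by an angle that is not a multiple of \<open>\<pi>\<close> is the product of three shears.\<close>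

lemma nn_integral_lborel_rotate:
  assumes c: "cmod c = 1" and f: "f \<in> borel_measurable borel"
  shows "(\<integral>\<^sup>+z. f (c * z) \<partial>lborel) = (\<integral>\<^sup>+z. f z \<partial>lborel)"
proof -
  have rot: "(\<integral>\<^sup>+z. g (b * z) \<partial>lborel) = (\<integral>\<^sup>+z. g z \<partial>lborel)"
    if b: "cmod b = 1" "Im b \<noteq> 0" and [measurable]: "g \<in> borel_measurable borel"
    for b and g :: "complex \<Rightarrow> ennreal"
  proof -
    \<comment> \<open>For \<open>b = exp (i theta)\<close> the slope \<open>t\<close> is
      \<open>- tan (theta / 2)\<close>, which requires \<open>q = sin theta\<close> to be
      nonzero.\<close>
    define p q t where "p = Re b" and "q = Im b" and "t = (p - 1) / q"
    have q: "q \<noteq> 0" and pq: "p\<^sup>2 + q\<^sup>2 = 1"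
      using b by (auto simp: p_def q_def cmod_def)
    have tq: "t * q = p - 1" using q by (simp add: t_def)
    have tp: "t * (1 + p) = - q"
    proof -
      have "q * (t * (1 + p)) = q * (- q)"
        using pq tq by (simp add: algebra_simps power2_eq_square) algebra
      then show ?thesis using q by (metis mult_left_cancel)
    qed
    define S R where "S = (\<lambda>z. z + complex_of_real (t * Im z))" and "R = (\<lambda>z. z + \<i> * complex_of_real (q * Re z))"
    have [measurable]: "S \<in> borel_measurable borel" "R \<in> borel_measurable borel"
      unfolding S_def R_def by (intro borel_measurable_continuous_onI continuous_intros)+
    have eq: "b * z = S (R (S z))" for z
    proof (rule complex_eqI)
      have "p * Re z - q * Im z = Re z + t * Im z + t * (Im z + q * (Re z + t * Im z))"
        using tq tp by algebra
      then show "Re (b * z) = Re (S (R (S z)))"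
        by (simp add: S_def R_def p_def q_def)
      have "p * Im z + q * Re z = Im z + q * (Re z + t * Im z)"
        using tq by algebra
      then show "Im (b * z) = Im (S (R (S z)))"
        by (simp add: S_def R_def p_def q_def)
    qed
    have "(\<integral>\<^sup>+z. g (S (R (S z))) \<partial>lborel) = (\<integral>\<^sup>+z. g (S (R z)) \<partial>lborel)"
      using nn_integral_shear_Re[of "\<lambda>z. g (S (R z))" t] by (simp add: S_def)
    also have "\<dots> = (\<integral>\<^sup>+z. g (S z) \<partial>lborel)"
      using nn_integral_shear_Im[of "\<lambda>z. g (S z)" q] by (simp add: R_def)
    also have "\<dots> = (\<integral>\<^sup>+z. g z \<partial>lborel)"
      using nn_integral_shear_Re[of g t] by (simp add: S_def)
    finally show ?thesis by (simp add: eq)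
  qed
  show ?thesis
  proof (cases "Im c = 0")
    case False
    then show ?thesis using rot c f by blast
  next
    case True
    \<comment> \<open>Here \<open>c\<close> is 1 or -1 and has no such factorization; it is written
      as \<open>\<i> * (- \<i> * c)\<close>, a product of two non-real rotations.\<close>
    then have "Im (- \<i> * c) \<noteq> 0"
      using c by (auto simp: cmod_def)
    have [measurable]: "(\<lambda>z. f (\<i> * z)) \<in> borel_measurable borel"
      by (intro measurable_compose[OF _ f] borel_measurable_continuous_onI continuous_intros)
    have "(\<integral>\<^sup>+z. f (\<i> * (- \<i> * c * z)) \<partial>lborel) = (\<integral>\<^sup>+z. f (\<i> * z) \<partial>lborel)"
      using \<open>Im (- \<i> * c) \<noteq> 0\<close> c by (intro rot[of "- \<i> * c" "\<lambda>z. f (\<i> * z)"]) (auto simp: norm_mult)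
    also have "\<dots> = (\<integral>\<^sup>+z. f z \<partial>lborel)"
      by (intro rot f) auto
    finally show ?thesis by (simp add: mult.assoc[symmetric])
  qed
qed

text \<open>The integrand splits into two one-dimensional Gaussians, each a multiple of the normal
  density of variance \<open>1 / (2 * c)\<close>.\<close>

lemma nn_integral_gaussian_complex:
  assumes "0 < c"
  shows "(\<integral>\<^sup>+z. ennreal (exp (- c * (cmod z)\<^sup>2)) \<partial>lborel) = ennreal (pi / c)"
proof -
  define \<sigma> where "\<sigma> = sqrt (1 / (2 * c))"
  have \<sigma>: "\<sigma> > 0" "\<sigma>\<^sup>2 = 1 / (2 * c)"
    using assms by (auto simp: \<sigma>_def)
  have g: "exp (- c * x\<^sup>2) = sqrt (pi / c) * normal_density 0 \<sigma> x" for x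
    using assms by (simp add: normal_density_def \<sigma> real_sqrt_divide field_simps)
  have one: "(\<integral>\<^sup>+x. ennreal (exp (- c * x\<^sup>2)) \<partial>lborel) = ennreal (sqrt (pi / c))"
  proof -
    have "(\<integral>\<^sup>+x. ennreal (normal_density 0 \<sigma> x) \<partial>lborel) = 1"
      using \<sigma>(1) by (subst nn_integral_eq_integral) (auto simp: integrable_normal_density integral_normal_density)
    then show ?thesis
      using assms unfolding g by (subst ennreal_mult) (auto simp: nn_integral_cmult)
  qed
  have "(\<integral>\<^sup>+z. ennreal (exp (- c * (cmod z)\<^sup>2)) \<partial>lborel) =
      (\<integral>\<^sup>+z. (\<Prod>b\<in>(Basis::complex set). ennreal (exp (- c * (z \<bullet> b)\<^sup>2))) \<partial>lborel)"
    by (intro nn_integral_cong)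
      (simp add: Basis_complex_def cmod_power2 exp_add[symmetric] ennreal_mult[symmetric] algebra_simps)
  also have "\<dots> = (\<Prod>b\<in>(Basis::complex set). \<integral>\<^sup>+x. ennreal (exp (- c * x\<^sup>2)) \<partial>lborel)"
    by (rule nn_integral_lborel_prod) auto
  also have "\<dots> = ennreal (pi / c)"
    using assms by (simp only: one) (simp add: Basis_complex_def ennreal_mult[symmetric])
  finally show ?thesis .
qed

section \<open>Normalization, rotation invariance and mean value property of the Gaussian
  measure\<close>

lemma prob_space_gauss_measure: "prob_space gauss_measure"
proof
  have "emeasure gauss_measure (space gauss_measure) =
      (\<integral>\<^sup>+z. ennreal (1 / pi) * ennreal (exp (- 1 * (cmod z)\<^sup>2)) \<partial>lborel)"
    unfolding gauss_measure_def
    by (subst emeasure_density) (auto simp: ennreal_mult[symmetric] field_simps intro!: nn_integral_cong)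
  also have "\<dots> = ennreal (1 / pi) * ennreal (pi / 1)"
    by (subst nn_integral_cmult) (auto simp only: nn_integral_gaussian_complex zero_less_one, measurable)
  also have "\<dots> = 1"
    by (simp add: ennreal_mult[symmetric])
  finally show "emeasure gauss_measure (space gauss_measure) = 1" .
qed

interpretation gauss: prob_space gauss_measure
  by (rule prob_space_gauss_measure)

lemma prob_gauss_UNIV [simp]: "measure gauss_measure UNIV = 1"
  using gauss.prob_space by simp

text \<open>Cauchy's integral formula at 0 for the function sending \<open>w\<close> to
  \<open>F (w * v)\<close>, on the unit circle parametrized by \<open>{0..1}\<close>.\<close>

lemma circle_mean_value:
  assumes F: "F holomorphic_on UNIV"
  shows "((\<lambda>t. F (exp (2 * of_real pi * \<i> * of_real t) * v)) has_integral F 0) {0..1}"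
proof -
  have "F \<circ> (\<lambda>w. w * v) holomorphic_on cball 0 1"
    by (rule holomorphic_on_compose[OF _ holomorphic_on_subset[OF F]]) (auto intro!: holomorphic_intros)
  then have "(\<lambda>w. F (w * v)) holomorphic_on cball 0 1"
    by (simp add: o_def)
  then have "((\<lambda>u. F (u * v) / u) has_contour_integral (2 * of_real pi * \<i> * F 0)) (circlepath 0 1)"
    using Cauchy_integral_circlepath_simple[of "\<lambda>w. F (w * v)" 0 1 0] by simp
  then have "((\<lambda>t. 2 * of_real pi * \<i> * F (exp (2 * of_real pi * \<i> * of_real t) * v)) has_integral
      (2 * of_real pi * \<i> * F 0)) {0..1}"
    unfolding has_contour_integral_def
    by (rule has_integral_eq[rotated])
      (simp add: vector_derivative_circlepath01, simp add: circlepath)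
  from has_integral_mult_right[OF this, of "1 / (2 * of_real pi * \<i>)"] show ?thesis
    by simp
qed

lemma gauss_measure_rotate:
  assumes c: "cmod c = 1"
  shows "distr gauss_measure borel (\<lambda>z. c * z) = gauss_measure"
proof (rule measure_eqI)
  fix X assume "X \<in> sets (distr gauss_measure borel (\<lambda>z. c * z))"
  then have X [measurable]: "X \<in> sets borel" by simp
  have [measurable]: "(\<lambda>z. c * z) \<in> borel_measurable borel"
    by (intro borel_measurable_continuous_onI continuous_intros)
  have "emeasure (distr gauss_measure borel (\<lambda>z. c * z)) X =
      (\<integral>\<^sup>+z. ennreal (exp (- (cmod (c * z))\<^sup>2) / pi) * indicator X (c * z) \<partial>lborel)"
    using c unfolding gauss_measure_def
    by (subst nn_integral_indicator[symmetric], simp, subst nn_integral_distr, simp, simp,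
        subst nn_integral_density) (simp_all add: norm_mult)
  also have "\<dots> = emeasure gauss_measure X"
    unfolding gauss_measure_def using c
    by (subst nn_integral_lborel_rotate[where f = "\<lambda>z. ennreal (exp (- (cmod z)\<^sup>2) / pi) * indicator X z"])
      (auto simp: emeasure_density)
  finally show "emeasure (distr gauss_measure borel (\<lambda>z. c * z)) X = emeasure gauss_measure X" .
qed simp

text \<open>By rotation invariance the integral equals its average over all rotations of
  \<open>F\<close>. After Fubini the inner average runs over a circle and equals \<open>F 0\<close>.
  The reproducing property of the kernels rests on this.\<close>

lemma gauss_mean_value:
  assumes F: "F holomorphic_on UNIV" and int: "integrable gauss_measure F"
  shows "(LINT z|gauss_measure. F z) = F 0"
proof -
  define E where "E = (\<lambda>t. exp (2 * of_real pi * \<i> * complex_of_real t))"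
  have E [simp]: "cmod (E t) = 1" for t by (simp add: E_def)
  have contF: "continuous_on UNIV F"
    using F by (rule holomorphic_on_imp_continuous_on)
  have contE: "continuous_on S E" for S
    unfolding E_def by (intro continuous_intros)
  have mF [measurable]: "F \<in> borel_measurable borel"
    using contF by (rule borel_measurable_continuous_onI)
  have mm [measurable]: "(\<lambda>z. c * z) \<in> borel_measurable borel" for c :: complex
    by (intro borel_measurable_continuous_onI continuous_intros)
  have mE: "(\<lambda>p. F (E (fst p) * snd p)) \<in> borel_measurable borel"
    by (intro borel_measurable_continuous_onI continuous_on_compose2[OF contF] continuous_on_mult
        continuous_on_compose2[OF contE[of UNIV]] continuous_intros) auto
  interpret P: pair_sigma_finite lborel gauss_measure ..
  \<comment> \<open>The indicator restricts the angle parameter to \<open>{0..1}\<close>, so that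
    Fubini can be applied with \<open>lborel\<close> itself.\<close>
  define h where "h = (\<lambda>t z. indicat_real {0..1} t *\<^sub>R F (E t * z))"
  have [measurable]: "case_prod h \<in> borel_measurable (lborel \<Otimes>\<^sub>M gauss_measure)"
    using mE unfolding h_def borel_prod[symmetric] split_beta by measurable
  have rot: "integrable gauss_measure (\<lambda>z. F (E t * z))"
      "(LINT z|gauss_measure. F (E t * z)) = (LINT z|gauss_measure. F z)"
      "(LINT z|gauss_measure. cmod (F (E t * z))) = (LINT z|gauss_measure. cmod (F z))" for t
  proof -
    show "integrable gauss_measure (\<lambda>z. F (E t * z))"
      using int by (subst (asm) gauss_measure_rotate[OF E[of t], symmetric], subst (asm) integrable_distr_eq) auto
    show "(LINT z|gauss_measure. F (E t * z)) = (LINT z|gauss_measure. F z)"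
      by (subst (2) gauss_measure_rotate[OF E[of t], symmetric], subst integral_distr) auto
    show "(LINT z|gauss_measure. cmod (F (E t * z))) = (LINT z|gauss_measure. cmod (F z))"
      by (subst (2) gauss_measure_rotate[OF E[of t], symmetric], subst integral_distr) auto
  qed
  have "integrable (lborel \<Otimes>\<^sub>M gauss_measure) (case_prod h)"
  proof (rule P.Fubini_integrable)
    show "integrable lborel (\<lambda>t. LINT z|gauss_measure. norm (case (t, z) of (t, z) \<Rightarrow> h t z))"
      by (simp add: h_def rot)
    show "AE t in lborel. integrable gauss_measure (\<lambda>z. case (t, z) of (t, z) \<Rightarrow> h t z)"
      by (simp add: h_def rot)
  qed simp
  then have "(LINT z|gauss_measure. LINT t|lborel. h t z) = (LINT t|lborel. LINT z|gauss_measure. h t z)"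
    by (rule P.Fubini_integral)
  moreover have "(LINT t|lborel. LINT z|gauss_measure. h t z) = (LINT z|gauss_measure. F z)"
    by (simp add: h_def rot)
  moreover have "(LINT t|lborel. h t z) = F 0" for z
  proof -
    have "continuous_on {0..1} (\<lambda>t. F (E t * z))"
      by (intro continuous_on_compose2[OF contF] continuous_intros contE) auto
    then have "set_integrable lborel {0..1} (\<lambda>t. F (E t * z))"
      by (rule borel_integrable_atLeastAtMost')
    from set_borel_integral_eq_integral(2)[OF this] show ?thesis
      using circle_mean_value[OF F, of z]
      by (auto simp: h_def E_def set_lebesgue_integral_def dest: integral_unique)
  qed
  ultimately show ?thesis
    by simp
qed

text \<open>Completing the square: the weight times the Gaussian density at \<open>u\<close> is the
  Gaussian density at \<open>u - x\<close>.\<close>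

lemma gauss_measure_shift:
  "distr (density gauss_measure (\<lambda>u. ennreal (exp (2 * Re (u * cnj x) - (cmod x)\<^sup>2)))) borel
     (\<lambda>u. u - x) = gauss_measure" (is "?M = _")
proof (rule measure_eqI)
  fix X assume "X \<in> sets ?M"
  then have X [measurable]: "X \<in> sets borel" by simp
  have [measurable]: "(\<lambda>u. exp (2 * Re (u * cnj x) - (cmod x)\<^sup>2)) \<in> borel_measurable borel"
    by (intro borel_measurable_continuous_onI continuous_intros)
  have e: "exp (- (cmod u)\<^sup>2) * exp (2 * Re (u * cnj x) - (cmod x)\<^sup>2) = exp (- (cmod (u - x))\<^sup>2)" for u
    by (simp only: exp_add[symmetric] cmod_power2) (simp add: power2_eq_square algebra_simps)
  have "emeasure ?M X =
      (\<integral>\<^sup>+u. ennreal (exp (- (cmod (- x + u))\<^sup>2) / pi) * indicator X (- x + u) \<partial>lborel)"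
    unfolding gauss_measure_def
    by (subst nn_integral_indicator[symmetric], simp, subst nn_integral_distr, simp, simp,
        subst nn_integral_density, simp, simp, subst nn_integral_density)
      (simp_all add: e[symmetric] ennreal_mult mult.assoc[symmetric] flip: times_divide_eq_left)
  also have "\<dots> = emeasure gauss_measure X"
    unfolding gauss_measure_def
    by (subst nn_integral_lborel_shift[where f = "\<lambda>z. ennreal (exp (- (cmod z)\<^sup>2) / pi) * indicator X z"])
      (auto simp: emeasure_density)
  finally show "emeasure ?M X = emeasure gauss_measure X" .
qed simp

text \<open>The value type is general: norms of Weyl translates use a real integrand, the adjoint
  formula a complex one.\<close>

lemma
  fixes F :: "complex \<Rightarrow> 'b::{banach, second_countable_topology}"
  assumes [measurable]: "F \<in> borel_measurable borel"
  shows integrable_gauss_shift: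
      "integrable gauss_measure (\<lambda>u. exp (2 * Re (u * cnj x) - (cmod x)\<^sup>2) *\<^sub>R F (u - x)) \<longleftrightarrow>
       integrable gauss_measure F" (is ?I)
    and integral_gauss_shift:
      "(LINT u|gauss_measure. exp (2 * Re (u * cnj x) - (cmod x)\<^sup>2) *\<^sub>R F (u - x)) =
       (LINT u|gauss_measure. F u)" (is ?E)
proof -
  have [measurable]: "(\<lambda>u. exp (2 * Re (u * cnj x) - (cmod x)\<^sup>2)) \<in> borel_measurable borel"
    by (intro borel_measurable_continuous_onI continuous_intros)
  show ?I
    by (subst (2) gauss_measure_shift[of x, symmetric], subst integrable_distr_eq)
      (auto simp: integrable_density)
  show ?E
    by (subst (2) gauss_measure_shift[of x, symmetric], subst integral_distr)
      (auto simp: integral_density)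
qed

section \<open>Weyl operators and coherent states\<close>

text \<open>Translation by \<open>x\<close>, multiplied by the normalized reproducing kernel at
  \<open>x\<close>. The squared modulus of this factor is exactly the weight in
  \<open>gauss_measure_shift\<close>, which makes the operator isometric.\<close>

definition weyl_fun :: "complex \<Rightarrow> (complex \<Rightarrow> complex) \<Rightarrow> complex \<Rightarrow> complex" where
  "weyl_fun x g u = exp (u * cnj x - of_real ((cmod x)\<^sup>2) / 2) * g (u - x)"

lemma cmod_weyl_fun:
  "(cmod (weyl_fun x g u))\<^sup>2 = exp (2 * Re (u * cnj x) - (cmod x)\<^sup>2) * (cmod (g (u - x)))\<^sup>2"
  by (simp add: weyl_fun_def norm_mult power_mult_distrib power2_eq_square exp_add[symmetric])

lemma fock_fun_borel [measurable]: "fock_fun g \<in> borel_measurable borel"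
  using fock_set_measurable[OF fock_fun, of g] by simp

lemma fock_fun_holomorphic: "fock_fun g holomorphic_on UNIV"
  using fock_fun[of g] by (simp add: fock_set_def)

lift_definition weyl_fock :: "complex \<Rightarrow> fock \<Rightarrow> fock" is weyl_fun
proof -
  fix x g assume g: "g \<in> fock_set"
  have hol: "g holomorphic_on UNIV" and [measurable]: "g \<in> borel_measurable borel"
    using g fock_set_measurable[OF g] by (auto simp: fock_set_def)
  have "g \<circ> (\<lambda>u. u - x) holomorphic_on UNIV"
    by (rule holomorphic_on_compose[OF _ holomorphic_on_subset[OF hol]]) (auto intro!: holomorphic_intros)
  then have "weyl_fun x g holomorphic_on UNIV"
    unfolding weyl_fun_def[abs_def] by (auto intro!: holomorphic_intros simp: o_def)
  moreover have "integrable gauss_measure (\<lambda>z. (cmod (weyl_fun x g z))\<^sup>2)"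
    using g integrable_gauss_shift[of "\<lambda>u. (cmod (g u))\<^sup>2" x]
    by (simp add: cmod_weyl_fun fock_set_def)
  ultimately show "weyl_fun x g \<in> fock_set"
    by (simp add: fock_set_def)
qed

lemma fock_eqI: "(\<And>z. fock_fun f z = fock_fun g z) \<Longrightarrow> f = g"
  by (simp add: fock_fun_inject[symmetric] fun_eq_iff)

lemma weyl_fock_add: "weyl_fock x (f + g) = weyl_fock x f + weyl_fock x g"
  by (rule fock_eqI) (simp add: weyl_fock.rep_eq plus_fock.rep_eq weyl_fun_def distrib_left)

lemma weyl_fock_diff: "weyl_fock x (f - g) = weyl_fock x f - weyl_fock x g"
  using weyl_fock_add[of x "f - g" g] by (simp add: algebra_simps)

lemma weyl_fock_scaleC: "weyl_fock x (fock_scaleC c f) = fock_scaleC c (weyl_fock x f)"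
  by (rule fock_eqI) (simp add: weyl_fock.rep_eq fock_scaleC.rep_eq weyl_fun_def)

text \<open>The two exponential factors cancel without a residual phase. Together with
  \<open>weyl_fock_adjoint\<close> this gives unitarity.\<close>

lemma weyl_fock_uminus_cancel: "weyl_fock (- x) (weyl_fock x f) = f"
proof (rule fock_eqI)
  fix u
  have "exp (- (u * cnj x) - x * cnj x / 2) * exp ((u + x) * cnj x - x * cnj x / 2) = 1"
    unfolding exp_add[symmetric] by (simp add: algebra_simps)
  then show "fock_fun (weyl_fock (- x) (weyl_fock x f)) u = fock_fun f u"
    by (simp add: weyl_fock.rep_eq weyl_fun_def complex_norm_square mult.assoc[symmetric] del: of_real_power)
qed

definition weyl_phase :: "complex \<Rightarrow> complex \<Rightarrow> complex" where
  "weyl_phase x y = exp (cnj x * y - x * cnj y)"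

lemma weyl_phase_uminus: "weyl_phase (- x) y = cnj (weyl_phase x y)"
  by (simp add: weyl_phase_def exp_cnj)

lemma cmod_weyl_phase [simp]: "cmod (weyl_phase x y) = 1"
  by (simp add: weyl_phase_def)

text \<open>The canonical commutation relation in Weyl form: both orders translate by
  \<open>x + y\<close>, and only the exponential factors differ.\<close>

lemma weyl_fock_commute:
  "weyl_fock x (weyl_fock y f) = fock_scaleC (weyl_phase x y) (weyl_fock y (weyl_fock x f))"
proof (rule fock_eqI)
  fix u
  have "exp (u * cnj x - x * cnj x / 2) * exp ((u - x) * cnj y - y * cnj y / 2) =
      exp (cnj x * y - x * cnj y) * (exp (u * cnj y - y * cnj y / 2) * exp ((u - y) * cnj x - x * cnj x / 2))"
    unfolding exp_add[symmetric] by (simp add: algebra_simps)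
  then show "fock_fun (weyl_fock x (weyl_fock y f)) u =
      fock_fun (fock_scaleC (weyl_phase x y) (weyl_fock y (weyl_fock x f))) u"
    by (simp add: weyl_fock.rep_eq fock_scaleC.rep_eq weyl_fun_def weyl_phase_def complex_norm_square
        mult.assoc[symmetric] diff_diff_eq add.commute[of y x] del: of_real_power)
qed

text \<open>The Gaussian change of variables by \<open>x\<close> undoes the translation of
  \<open>f\<close> and moves it onto \<open>g\<close>.\<close>

lemma weyl_fock_adjoint: "fock_cinner (weyl_fock x f) g = fock_cinner f (weyl_fock (- x) g)"
proof -
  have [measurable]: "cnj \<in> borel_measurable borel"
    by (intro borel_measurable_continuous_onI continuous_intros)
  \<comment> \<open>Extracts the weight of the Gaussian shift; what remains is the conjugated factor
    of the Weyl operator of \<open>- x\<close>, evaluated at \<open>u - x\<close>.\<close>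
  have *: "exp (u * cnj x - x * cnj x / 2) * a = exp (2 * Re (u * cnj x) - (cmod x)\<^sup>2) *\<^sub>R
      (a * cnj (exp (- ((u - x) * cnj x) - x * cnj x / 2)))" for u a
  proof -
    define r where "r = 2 * Re (u * cnj x) - (cmod x)\<^sup>2"
    have r: "complex_of_real r = u * cnj x + cnj u * x - x * cnj x"
      using complex_add_cnj[of "u * cnj x"]
      by (simp only: r_def of_real_diff complex_norm_square) simp
    have "exp (u * cnj x - x * cnj x / 2) =
        of_real (exp r) * cnj (exp (- ((u - x) * cnj x) - x * cnj x / 2))"
      unfolding exp_of_real[symmetric] r exp_cnj exp_add[symmetric] by (simp add: algebra_simps)
    then show ?thesis
      unfolding r_def[symmetric] by (simp add: scaleR_conv_of_real mult_ac)
  qed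
  have "fock_cinner (weyl_fock x f) g = (LINT u|gauss_measure. exp (2 * Re (u * cnj x) - (cmod x)\<^sup>2) *\<^sub>R
      (fock_fun f (u - x) * cnj (fock_fun (weyl_fock (- x) g) (u - x))))"
    unfolding fock_cinner_def
  proof (intro Bochner_Integration.integral_cong refl)
    fix u
    show "fock_fun (weyl_fock x f) u * cnj (fock_fun g u) = exp (2 * Re (u * cnj x) - (cmod x)\<^sup>2) *\<^sub>R
        (fock_fun f (u - x) * cnj (fock_fun (weyl_fock (- x) g) (u - x)))"
      using *[of u "fock_fun f (u - x) * cnj (fock_fun g u)"]
      by (simp add: weyl_fock.rep_eq weyl_fun_def complex_norm_square mult_ac del: of_real_power)
  qed
  also have "\<dots> = fock_cinner f (weyl_fock (- x) g)"
    unfolding fock_cinner_def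
    by (rule integral_gauss_shift[where F = "\<lambda>u. fock_fun f u * cnj (fock_fun (weyl_fock (- x) g) u)"]) measurable
  finally show ?thesis .
qed

lemma norm_fock_power2: "of_real ((norm f)\<^sup>2) = fock_cinner f f"
  by (simp add: norm_fock_eq fock_cinner_same)

lemma norm_weyl_fock [simp]: "norm (weyl_fock x f) = norm f"
proof -
  have "fock_cinner (weyl_fock x f) (weyl_fock x f) = fock_cinner f f"
    by (simp add: weyl_fock_adjoint weyl_fock_uminus_cancel)
  then have "(norm (weyl_fock x f))\<^sup>2 = (norm f)\<^sup>2"
    by (metis norm_fock_power2 of_real_eq_iff)
  then show ?thesis by simp
qed

lift_definition weyl_op :: "complex \<Rightarrow> fock \<Rightarrow>\<^sub>L fock" is weyl_fock
  by (rule bounded_linear_intro[where K = 1])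
    (simp_all add: weyl_fock_add scaleR_fock_def weyl_fock_scaleC)

lemma norm_weyl_op_le: "norm (weyl_op x) \<le> 1"
  by (rule norm_blinfun_bound) (simp_all add: weyl_op.rep_eq)

lemma fock_cinner_diff_left: "fock_cinner (f - g) h = fock_cinner f h - fock_cinner g h"
  using fock_cinner_add_left[of "f - g" g h] by simp

lemma fock_cinner_diff_right: "fock_cinner h (f - g) = fock_cinner h f - fock_cinner h g"
  by (subst (1 2 3) fock_cinner_commute) (simp add: fock_cinner_diff_left)

lemma fock_cinner_scaleC_right: "fock_cinner f (fock_scaleC c g) = cnj c * fock_cinner f g"
  by (subst (1 2) fock_cinner_commute) (simp add: fock_cinner_scaleC_left)

lemma fock_scaleC_diff_right: "fock_scaleC c (f - g) = fock_scaleC c f - fock_scaleC c g"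
  by (rule fock_eqI) (simp add: fock_scaleC.rep_eq minus_fock.rep_eq right_diff_distrib)

text \<open>A unimodular factor on \<open>f\<close> makes the complex inner product nonnegative. It
  then agrees with the real one, to which Cauchy-Schwarz applies.\<close>

lemma cmod_fock_cinner_le: "cmod (fock_cinner f g) \<le> norm f * norm g"
proof (cases "fock_cinner f g = 0")
  case False
  define c where "c = cnj (fock_cinner f g) / cmod (fock_cinner f g)"
  have "cmod (fock_cinner f g) = Re (c * fock_cinner f g)"
    using False by (simp add: c_def mult.commute[of "cnj _"] complex_norm_square[symmetric] power2_eq_square)
  also have "\<dots> = inner (fock_scaleC c f) g"
    by (simp add: inner_fock_def fock_cinner_scaleC_left)
  also have "\<dots> \<le> norm (fock_scaleC c f) * norm g"
    by (rule norm_cauchy_schwarz)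
  also have "\<dots> = norm f * norm g"
    using False by (simp add: norm_fock_scaleC c_def norm_divide)
  finally show ?thesis .
qed simp

section \<open>Coherent states and the reproducing property\<close>

lift_definition fock_one :: fock is "\<lambda>_. 1"
  by (simp add: fock_set_def)

lemma norm_fock_one [simp]: "norm fock_one = 1"
  by (simp add: norm_fock_eq fock_one.rep_eq)

text \<open>These are the normalized reproducing kernels. As Weyl translates of the constant 1 they
  inherit unit norm and commutation rules at once.\<close>

definition coherent :: "complex \<Rightarrow> fock" where
  "coherent z = weyl_fock z fock_one"

lemma fock_fun_coherent: "fock_fun (coherent z) u = exp (u * cnj z - of_real ((cmod z)\<^sup>2) / 2)"
  by (simp add: coherent_def weyl_fock.rep_eq weyl_fun_def fock_one.rep_eq)

lemma norm_coherent [simp]: "norm (coherent z) = 1"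
  by (simp add: coherent_def)

text \<open>Moving the Weyl operator to the left factor leaves the integral of an entire function,
  which is its value at 0.\<close>

lemma fock_cinner_coherent: "fock_cinner f (coherent z) = exp (- of_real ((cmod z)\<^sup>2) / 2) * fock_fun f z"
proof -
  have "fock_cinner f (coherent z) = fock_cinner (weyl_fock (- z) f) fock_one"
    by (simp add: coherent_def weyl_fock_adjoint)
  also have "\<dots> = (LINT u|gauss_measure. fock_fun (weyl_fock (- z) f) u)"
    by (simp add: fock_cinner_def fock_one.rep_eq)
  also have "\<dots> = fock_fun (weyl_fock (- z) f) 0"
    using fock_integrable[of "weyl_fock (- z) f" fock_one]
    by (intro gauss_mean_value fock_fun_holomorphic) (simp add: fock_one.rep_eq)
  also have "\<dots> = exp (- of_real ((cmod z)\<^sup>2) / 2) * fock_fun f z"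
    by (simp add: weyl_fock.rep_eq weyl_fun_def)
  finally show ?thesis .
qed

text \<open>Two unit vectors with inner product \<open>exp (- s)\<close>, where
  \<open>s = (cmod x)\<^sup>2 / 2\<close>; then \<open>1 - exp (- s) \<le> s\<close> is
  used.\<close>

lemma norm_coherent_diff_one: "norm (coherent x - fock_one) \<le> cmod x"
proof -
  have "(norm (coherent x - fock_one))\<^sup>2 = 2 - 2 * inner fock_one (coherent x)"
    by (simp add: power2_norm_eq_inner inner_diff inner_commute norm_eq_1[symmetric])
      (simp add: power2_norm_eq_inner[symmetric])
  also have "inner fock_one (coherent x) = exp (- (cmod x)\<^sup>2 / 2)"
    by (simp add: inner_fock_def fock_cinner_coherent fock_one.rep_eq Re_exp)
  also have "2 - 2 * exp (- (cmod x)\<^sup>2 / 2) \<le> (cmod x)\<^sup>2"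
    using exp_ge_add_one_self[of "- (cmod x)\<^sup>2 / 2"] by simp
  finally show ?thesis
    by (rule power2_le_imp_le) simp
qed

text \<open>Commuting past the Weyl operator of \<open>w\<close> produces exactly the phase. What is
  left is a unitary image of \<open>coherent x - fock_one\<close>, so the bound is uniform in
  \<open>w\<close>.\<close>

lemma norm_weyl_coherent_diff:
  "norm (weyl_fock x (coherent w) - fock_scaleC (weyl_phase x w) (coherent w)) \<le> cmod x"
proof -
  have "weyl_fock x (coherent w) - fock_scaleC (weyl_phase x w) (coherent w) =
      fock_scaleC (weyl_phase x w) (weyl_fock w (coherent x - fock_one))"
    by (simp add: coherent_def weyl_fock_commute[of x w] fock_scaleC_diff_right weyl_fock_diff)
  then show ?thesis
    by (simp add: norm_fock_scaleC norm_coherent_diff_one)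
qed

section \<open>Operators with norm-continuous Weyl orbits\<close>

text \<open>By unitarity this has the same norm as \<open>W\<^sub>x A W\<^sub>x\<^sup>* - A\<close>;
  the commutator form has the advantage of a Leibniz rule.\<close>

definition weyl_comm :: "complex \<Rightarrow> (fock \<Rightarrow>\<^sub>L fock) \<Rightarrow> fock \<Rightarrow>\<^sub>L fock" where
  "weyl_comm x A = (weyl_op x o\<^sub>L A) - (A o\<^sub>L weyl_op x)"

text \<open>
  The operators \<open>A\<close> for which \<open>x \<mapsto> W\<^sub>x A W\<^sub>x\<^sup>*\<close> is norm continuous, where \<open>W\<^sub>x\<close> is the Weyl operator.
\<close>

definition weyl_continuous :: "(fock \<Rightarrow>\<^sub>L fock) set" where
  "weyl_continuous = {A \<in> fock_operators. ((\<lambda>x. weyl_comm x A) \<longlongrightarrow> 0) (at 0)}"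

lemma weyl_comm_apply:
  "blinfun_apply (weyl_comm x A) f = weyl_fock x (blinfun_apply A f) - blinfun_apply A (weyl_fock x f)"
  by (simp add: weyl_comm_def blinfun.diff_left weyl_op.rep_eq)

lemma weyl_comm_add: "weyl_comm x (A + B) = weyl_comm x A + weyl_comm x B"
  by (rule blinfun_eqI) (simp add: weyl_comm_apply blinfun.add_left weyl_fock_add)

lemma weyl_comm_diff: "weyl_comm x (A - B) = weyl_comm x A - weyl_comm x B"
  by (rule blinfun_eqI) (simp add: weyl_comm_apply blinfun.diff_left weyl_fock_diff)

text \<open>Add and subtract \<open>A W\<^sub>x B\<close>. This Leibniz rule yields closure under
  products.\<close>

lemma weyl_comm_compose: "weyl_comm x (A o\<^sub>L B) = (weyl_comm x A o\<^sub>L B) + (A o\<^sub>L weyl_comm x B)"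
  by (rule blinfun_eqI) (simp add: weyl_comm_apply blinfun.add_left blinfun.diff_right)

lemma weyl_comm_scalar: "weyl_comm x (scalar_op c) = 0"
  by (rule blinfun_eqI) (simp add: weyl_comm_apply scalar_op.rep_eq weyl_fock_scaleC)

text \<open>A bound uniform in \<open>x\<close>, which lets the commutator condition pass to norm
  limits.\<close>

lemma norm_weyl_comm_le: "norm (weyl_comm x A) \<le> 2 * norm A"
proof -
  have "norm (weyl_comm x A) \<le> norm (weyl_op x o\<^sub>L A) + norm (A o\<^sub>L weyl_op x)"
    unfolding weyl_comm_def by (rule norm_triangle_ineq4)
  also have "\<dots> \<le> norm (weyl_op x) * norm A + norm A * norm (weyl_op x)"
    by (intro add_mono norm_blinfun_compose)
  also have "\<dots> \<le> 1 * norm A + norm A * 1"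
    by (intro add_mono mult_mono norm_weyl_op_le) auto
  finally show ?thesis by simp
qed

section \<open>Adjoints\<close>

lemma fock_eq_by_cinner: "(\<And>h. fock_cinner f h = fock_cinner g h) \<Longrightarrow> f = g"
  using fock_cinner_eq_0[of "f - g"] by (simp add: fock_cinner_diff_left)

lemma is_adjoint_sym: "is_adjoint A B \<Longrightarrow> is_adjoint B A"
  unfolding is_adjoint_def
proof (intro allI)
  fix f g
  assume *: "\<forall>f g. fock_cinner (blinfun_apply A f) g = fock_cinner f (blinfun_apply B g)"
  have "fock_cinner (blinfun_apply B f) g = cnj (fock_cinner g (blinfun_apply B f))"
    by (rule fock_cinner_commute)
  also have "\<dots> = cnj (fock_cinner (blinfun_apply A g) f)"
    by (simp add: *)
  also have "\<dots> = fock_cinner f (blinfun_apply A g)"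
    by (rule fock_cinner_commute[symmetric])
  finally show "fock_cinner (blinfun_apply B f) g = fock_cinner f (blinfun_apply A g)" .
qed

text \<open>With \<open>g = B f\<close>, the square of \<open>norm g\<close> is the inner product of
  \<open>A g\<close> and \<open>f\<close>; Cauchy-Schwarz and division by \<open>norm g\<close> give
  the claim.\<close>

lemma is_adjoint_norm_le:
  assumes "is_adjoint A B" shows "norm B \<le> norm A"
proof (rule norm_blinfun_bound)
  fix f
  let ?g = "blinfun_apply B f"
  have "(norm ?g)\<^sup>2 = cmod (fock_cinner (blinfun_apply A ?g) f)"
    using assms norm_fock_power2[of ?g] unfolding is_adjoint_def
    by (metis abs_of_nonneg norm_of_real zero_le_power2)
  also have "\<dots> \<le> norm (blinfun_apply A ?g) * norm f"
    by (rule cmod_fock_cinner_le)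
  also have "\<dots> \<le> norm A * norm ?g * norm f"
    by (intro mult_right_mono norm_blinfun) auto
  finally have "norm ?g * norm ?g \<le> (norm A * norm f) * norm ?g"
    by (simp add: power2_eq_square mult_ac)
  then show "norm ?g \<le> norm A * norm f"
    by (cases "?g = 0") (auto dest: mult_right_le_imp_le)
qed simp

text \<open>\<open>B\<close> is a priori only real linear; the adjoint identity forces complex
  linearity.\<close>

lemma is_adjoint_fock_operators:
  assumes "is_adjoint A B" shows "B \<in> fock_operators"
  unfolding fock_operators_def
proof (intro CollectI allI fock_eq_by_cinner)
  fix c f h
  from is_adjoint_sym[OF assms] show "fock_cinner (blinfun_apply B (fock_scaleC c f)) h =
      fock_cinner (fock_scaleC c (blinfun_apply B f)) h"
    by (simp add: is_adjoint_def fock_cinner_scaleC_left)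
qed

text \<open>Taking adjoints reverses products and turns the Weyl operator of \<open>- x\<close> into
  that of \<open>x\<close>, hence both sign changes.\<close>

lemma is_adjoint_weyl_comm:
  assumes "is_adjoint A B" shows "is_adjoint (weyl_comm (- x) A) (- weyl_comm x B)"
  using assms
  by (simp add: is_adjoint_def weyl_comm_apply fock_cinner_diff_left fock_cinner_diff_right
      weyl_fock_adjoint blinfun.minus_left)

section \<open>Norm closedness and algebra structure\<close>

lemma closed_fock_operators: "closed fock_operators"
proof -
  have cont: "continuous_on UNIV (fock_scaleC c)" for c
    using linear_continuous_on[OF blinfun.bounded_linear_right[of "scalar_op c"]]
    by (simp add: scalar_op.rep_eq)
  have "closed {A. blinfun_apply A (fock_scaleC c f) = fock_scaleC c (blinfun_apply A f)}" for c f
    by (intro closed_Collect_eq continuous_on_compose2[OF cont] continuous_intros) auto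
  then have "closed (\<Inter>c f. {A. blinfun_apply A (fock_scaleC c f) = fock_scaleC c (blinfun_apply A f)})"
    by (intro closed_INT) auto
  also have "(\<Inter>c f. {A. blinfun_apply A (fock_scaleC c f) = fock_scaleC c (blinfun_apply A f)}) = fock_operators"
    by (auto simp: fock_operators_def)
  finally show ?thesis .
qed

lemma closed_weyl_continuous: "closed weyl_continuous"
  unfolding closed_sequential_limits
proof (intro allI impI, elim conjE)
  fix X A assume X: "\<forall>n. X n \<in> weyl_continuous" and lim: "X \<longlonglongrightarrow> A"
  have "A \<in> fock_operators"
    using closed_fock_operators X lim unfolding closed_sequential_limits weyl_continuous_def by blast
  moreover have "((\<lambda>x. weyl_comm x A) \<longlongrightarrow> 0) (at 0)"
  proof (rule tendstoI)
    fix e :: real assume "e > 0"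
    \<comment> \<open>A quarter of \<open>e\<close> suffices: \<open>norm_weyl_comm_le\<close>
      doubles it, and the commutator with \<open>X n\<close> takes the other half.\<close>
    then obtain n where n: "norm (A - X n) < e / 4"
      using lim unfolding lim_sequentially dist_norm
      by (metis divide_pos_pos zero_less_numeral norm_minus_commute order_refl)
    have "\<forall>\<^sub>F x in at 0. dist (weyl_comm x (X n)) 0 < e / 2"
      using X \<open>e > 0\<close> by (intro tendstoD) (auto simp: weyl_continuous_def)
    then show "\<forall>\<^sub>F x in at 0. dist (weyl_comm x A) 0 < e"
    proof eventually_elim
      case (elim x)
      have "norm (weyl_comm x A) \<le> norm (weyl_comm x (A - X n)) + norm (weyl_comm x (X n))"
        using norm_triangle_ineq[of "weyl_comm x (A - X n)" "weyl_comm x (X n)"]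
        by (simp add: weyl_comm_diff)
      then show ?case
        using elim n norm_weyl_comm_le[of x "A - X n"] by simp
    qed
  qed
  ultimately show "A \<in> weyl_continuous" by (simp add: weyl_continuous_def)
qed

lemma C_star_subalgebra_weyl_continuous: "C_star_subalgebra weyl_continuous"
proof -
  have zero: "0 \<in> weyl_continuous"
  proof -
    have "weyl_comm x 0 = 0" for x
      by (rule blinfun_eqI) (use weyl_fock_diff[of x 0 0] in \<open>simp add: weyl_comm_apply\<close>)
    then show ?thesis
      by (simp add: weyl_continuous_def fock_operators_def)
        (metis fock_cinner_scaleC_left mult_zero_right fock_cinner_eq_0 fock_cinner_diff_left diff_self)
  qed
  have sum: "A + B \<in> weyl_continuous" and prod: "A o\<^sub>L B \<in> weyl_continuous"
    if A: "A \<in> weyl_continuous" and B: "B \<in> weyl_continuous" for A B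
  proof -
    have ops: "A \<in> fock_operators" "B \<in> fock_operators"
      and lims: "((\<lambda>x. weyl_comm x A) \<longlongrightarrow> 0) (at 0)" "((\<lambda>x. weyl_comm x B) \<longlongrightarrow> 0) (at 0)"
      using A B by (auto simp: weyl_continuous_def)
    have add: "fock_scaleC c (f + g) = fock_scaleC c f + fock_scaleC c g" for c f g
      by (rule fock_eqI) (simp add: fock_scaleC.rep_eq plus_fock.rep_eq distrib_left)
    show "A + B \<in> weyl_continuous"
      using ops tendsto_add[OF lims]
      by (simp add: weyl_continuous_def fock_operators_def weyl_comm_add blinfun.add_left add)
    have "((\<lambda>x. (weyl_comm x A o\<^sub>L B) + (A o\<^sub>L weyl_comm x B)) \<longlongrightarrow> (0 o\<^sub>L B) + (A o\<^sub>L 0)) (at 0)"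
      by (intro tendsto_intros lims bounded_bilinear.tendsto[OF bounded_bilinear_blinfun_compose])
    then show "A o\<^sub>L B \<in> weyl_continuous"
      using ops by (simp add: weyl_continuous_def fock_operators_def weyl_comm_compose)
  qed
  \<comment> \<open>Scalar operators belong to the set, so closure under scalar multiples becomes a
    case of closure under products.\<close>
  have scalar: "scalar_op c \<in> weyl_continuous" for c
    by (simp add: weyl_continuous_def weyl_comm_scalar fock_operators_def scalar_op.rep_eq)
      (metis fock_eqI fock_scaleC.rep_eq mult.left_commute)
  have adj: "B \<in> weyl_continuous" if A: "A \<in> weyl_continuous" and adj: "is_adjoint A B" for A B
  proof -
    have "((\<lambda>x. weyl_comm x A) \<longlongrightarrow> 0) (at 0)"
      using A by (simp add: weyl_continuous_def)
    \<comment> \<open>The adjoint rule relates \<open>x\<close> to \<open>- x\<close>; reflection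
      preserves the punctured neighbourhoods of 0.\<close>
    moreover have "filterlim (\<lambda>x. - x) (at 0) (at (0::complex))"
      by (auto simp: filterlim_at eventually_at intro!: tendsto_eq_intros exI[of _ 1])
    ultimately have "((\<lambda>x. weyl_comm (- x) A) \<longlongrightarrow> 0) (at 0)"
      by (rule filterlim_compose)
    then have "((\<lambda>x. weyl_comm x B) \<longlongrightarrow> 0) (at 0)"
      by (rule Lim_transform_bound[rotated])
        (use is_adjoint_norm_le[OF is_adjoint_weyl_comm[OF adj]] in simp)
    then show ?thesis
      using is_adjoint_fock_operators[OF adj] by (simp add: weyl_continuous_def)
  qed
  have "weyl_continuous \<subseteq> fock_operators"
    by (auto simp: weyl_continuous_def)
  then show ?thesis
    unfolding C_star_subalgebra_def
  proof (intro conjI ballI allI impI closed_weyl_continuous zero)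
    fix A B c
    assume A: "A \<in> weyl_continuous"
    show "scalar_op c o\<^sub>L A \<in> weyl_continuous"
      by (rule prod[OF scalar A])
    show "A + B \<in> weyl_continuous" "A o\<^sub>L B \<in> weyl_continuous" if "B \<in> weyl_continuous"
      using sum[OF A that] prod[OF A that] .
    show "B \<in> weyl_continuous" if "is_adjoint A B"
      using adj[OF A that] .
  qed
qed

text \<open>
  Near \<open>k\<^sub>w\<close> the operator \<open>W\<^sub>x\<close> acts as multiplication by the phase \<open>exp (2 i Im (w x\<^sup>*))\<close>. When
  \<open>\<bar>z - w\<bar>\<close> is large, some small \<open>x\<close> gives \<open>k\<^sub>z\<close> and \<open>k\<^sub>w\<close> opposite phases, so that a small
  commutator \<open>[W\<^sub>x, A]\<close> forces \<open>\<langle>A k\<^sub>w, k\<^sub>z\<rangle>\<close> to be small.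
\<close>

lemma cmod_cinner_coherent_le:
  assumes A: "A \<in> fock_operators" and "z \<noteq> w"
  defines "x \<equiv> - \<i> * of_real pi / (2 * cnj (z - w))"
  shows "2 * cmod (fock_cinner (blinfun_apply A (coherent w)) (coherent z)) \<le>
    norm (weyl_comm x A) + 2 * norm A * cmod x"
proof -
  let ?k = coherent and ?A = "blinfun_apply A"
  define b where "b = fock_cinner (?A (?k w)) (?k z)"
  \<comment> \<open>The vectors \<open>d\<close> and \<open>e\<close> measure how far the two
    coherent states are from being eigenvectors of the Weyl operators of \<open>- x\<close> and
    \<open>x\<close>.\<close>
  define d where "d = weyl_fock (- x) (?k z) - fock_scaleC (weyl_phase (- x) z) (?k z)"
  define e where "e = weyl_fock x (?k w) - fock_scaleC (weyl_phase x w) (?k w)"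
  have "fock_cinner (weyl_fock x (?A (?k w))) (?k z) =
      fock_cinner (?A (?k w)) (fock_scaleC (weyl_phase (- x) z) (?k z) + d)"
    by (simp add: weyl_fock_adjoint d_def)
  also have "\<dots> = weyl_phase x z * b + fock_cinner (?A (?k w)) d"
    unfolding d_def
    by (simp add: fock_cinner_diff_right fock_cinner_scaleC_right weyl_phase_uminus b_def)
  finally have 1: "fock_cinner (weyl_fock x (?A (?k w))) (?k z) = weyl_phase x z * b + fock_cinner (?A (?k w)) d" .
  have "?A (weyl_fock x (?k w)) = fock_scaleC (weyl_phase x w) (?A (?k w)) + ?A e"
    using A by (simp add: e_def blinfun.diff_right fock_operators_def)
  then have 2: "fock_cinner (?A (weyl_fock x (?k w))) (?k z) = weyl_phase x w * b + fock_cinner (?A e) (?k z)"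
    by (simp add: fock_cinner_add_left fock_cinner_scaleC_left b_def)
  \<comment> \<open>By the choice of \<open>x\<close> the two exponents differ by exactly
    \<open>i pi\<close>. The phases are opposite, so the two multiples of \<open>b\<close> add up in
    the commutator instead of cancelling.\<close>
  have "weyl_phase x z = - weyl_phase x w"
  proof -
    have "cnj x * (z - w) = \<i> * of_real pi / 2" "x * cnj (z - w) = - \<i> * of_real pi / 2"
      using \<open>z \<noteq> w\<close> by (simp_all add: x_def field_simps)
    then have "cnj x * (z - w) - x * cnj (z - w) = \<i> * of_real pi"
      by (simp only:) simp
    then have "cnj x * z - x * cnj z = (cnj x * w - x * cnj w) + \<i> * of_real pi"
      by (simp only: right_diff_distrib complex_cnj_diff) (simp add: algebra_simps)
    then show ?thesis
      by (simp add: weyl_phase_def exp_add)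
  qed
  with 1 2 have "- 2 * weyl_phase x w * b = fock_cinner (blinfun_apply (weyl_comm x A) (?k w)) (?k z)
      - fock_cinner (?A (?k w)) d + fock_cinner (?A e) (?k z)"
    by (simp add: weyl_comm_apply fock_cinner_diff_left)
  moreover have "2 * cmod b = cmod (- 2 * weyl_phase x w * b)"
    by (simp add: norm_mult)
  ultimately have "2 * cmod b = cmod (fock_cinner (blinfun_apply (weyl_comm x A) (?k w)) (?k z)
      - fock_cinner (?A (?k w)) d + fock_cinner (?A e) (?k z))"
    by simp
  also have "\<dots> \<le> cmod (fock_cinner (blinfun_apply (weyl_comm x A) (?k w)) (?k z))
      + cmod (fock_cinner (?A (?k w)) d) + cmod (fock_cinner (?A e) (?k z))"
    by (intro order_trans[OF norm_triangle_ineq] add_mono norm_triangle_ineq4 order_refl)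
  also have "\<dots> \<le> norm (weyl_comm x A) * 1 * 1 + norm A * 1 * cmod x + norm A * cmod x * 1"
  proof (intro add_mono order_trans[OF cmod_fock_cinner_le] mult_mono order_trans[OF norm_blinfun])
    show "norm d \<le> cmod x"
      using norm_weyl_coherent_diff[of "- x" z] by (simp add: d_def)
    show "norm e \<le> cmod x"
      using norm_weyl_coherent_diff[of x w] by (simp add: e_def)
  qed auto
  finally show ?thesis by (simp add: b_def mult_ac)
qed

text \<open>The \<open>x\<close> in \<open>cmod_cinner_coherent_le\<close> has modulus
  \<open>pi / (2 * cmod (z - w))\<close>. It tends to 0 through nonzero values, and both terms of
  that bound vanish in the limit.\<close>

lemma weyl_continuous_coherent_tendsto_0:
  assumes A: "A \<in> weyl_continuous" and lim: "filterlim (\<lambda>t. z t - w t) at_infinity F"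
  shows "((\<lambda>t. fock_cinner (blinfun_apply A (coherent (w t))) (coherent (z t))) \<longlongrightarrow> 0) F"
proof -
  define x where "x = (\<lambda>t. - \<i> * of_real pi / (2 * cnj (z t - w t)))"
  have ne: "\<forall>\<^sub>F t in F. z t - w t \<noteq> 0"
    using lim by (rule filterlim_at_infinity_imp_eventually_ne)
  have "((\<lambda>t. inverse (z t - w t)) \<longlongrightarrow> 0) F"
    by (rule filterlim_compose[OF tendsto_inverse_0 lim])
  then have "((\<lambda>t. - \<i> * of_real pi / 2 * cnj (inverse (z t - w t))) \<longlongrightarrow> - \<i> * of_real pi / 2 * cnj 0) F"
    by (intro tendsto_intros)
  moreover have "- \<i> * of_real pi / 2 * cnj (inverse (z t - w t)) = x t" for t
    by (simp only: x_def complex_cnj_inverse divide_inverse inverse_mult_distrib mult.assoc)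
  ultimately have x0: "(x \<longlongrightarrow> 0) F"
    by simp
  moreover have "\<forall>\<^sub>F t in F. x t \<noteq> 0"
    using ne by eventually_elim (simp add: x_def)
  ultimately have "filterlim x (at 0) F"
    by (simp add: filterlim_at)
  moreover have "((\<lambda>x. weyl_comm x A) \<longlongrightarrow> 0) (at 0)"
    using A by (simp add: weyl_continuous_def)
  ultimately have "((\<lambda>t. weyl_comm (x t) A) \<longlongrightarrow> 0) F"
    by (rule filterlim_compose[rotated])
  then have "((\<lambda>t. (norm (weyl_comm (x t) A) + 2 * norm A * cmod (x t)) / 2) \<longlongrightarrow>
      (norm (0 :: fock \<Rightarrow>\<^sub>L fock) + 2 * norm A * cmod 0) / 2) F"
    using x0 by (intro tendsto_intros) auto
  then have lim0: "((\<lambda>t. (norm (weyl_comm (x t) A) + 2 * norm A * cmod (x t)) / 2) \<longlongrightarrow> 0) F"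
    by simp
  show ?thesis
  proof (rule Lim_null_comparison[OF _ lim0])
    show "\<forall>\<^sub>F t in F. norm (fock_cinner (blinfun_apply A (coherent (w t))) (coherent (z t)))
        \<le> (norm (weyl_comm (x t) A) + 2 * norm A * cmod (x t)) / 2"
      using ne
    proof eventually_elim
      case (elim t)
      then show ?case
        using cmod_cinner_coherent_le[of A "z t" "w t"] A
        by (simp add: x_def weyl_continuous_def)
    qed
  qed
qed

section \<open>Toeplitz operators\<close>

lemma nn_integral_mult_le_of_squares:
  fixes f g :: "'a \<Rightarrow> real"
  assumes [measurable]: "f \<in> borel_measurable M" "g \<in> borel_measurable M"
    and f: "(\<integral>\<^sup>+x. ennreal ((f x)\<^sup>2) \<partial>M) \<le> ennreal (a\<^sup>2)"
    and g: "(\<integral>\<^sup>+x. ennreal ((g x)\<^sup>2) \<partial>M) \<le> ennreal (b\<^sup>2)"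
    and nn: "\<And>x. 0 \<le> f x" "\<And>x. 0 \<le> g x" "0 \<le> a" "0 \<le> b"
  shows "(\<integral>\<^sup>+x. ennreal (f x * g x) \<partial>M) \<le> ennreal (a * b)"
proof -
  define I where "I = (\<integral>\<^sup>+x. ennreal (f x) * ennreal (g x) \<partial>M)"
  have "I\<^sup>2 \<le> (\<integral>\<^sup>+x. ennreal (f x) ^ 2 \<partial>M) * (\<integral>\<^sup>+x. ennreal (g x) ^ 2 \<partial>M)"
    unfolding I_def by (rule Cauchy_Schwarz_nn_integral) auto
  also have "\<dots> \<le> ennreal (a\<^sup>2) * ennreal (b\<^sup>2)"
    using f g nn by (intro mult_mono) (auto simp: ennreal_power)
  also have "\<dots> = ennreal ((a * b)\<^sup>2)"
    by (simp add: ennreal_mult[symmetric] power_mult_distrib)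
  finally have *: "I\<^sup>2 \<le> ennreal ((a * b)\<^sup>2)" .
  have "I \<le> ennreal (a * b)"
  proof (cases I)
    case (real r)
    then have "r\<^sup>2 \<le> (a * b)\<^sup>2"
      using * by (simp add: ennreal_power ennreal_le_iff)
    then show ?thesis
      using real nn by (auto intro!: ennreal_leI power2_le_imp_le)
  next
    case top
    then show ?thesis using * by (simp add: power2_eq_square top_unique)
  qed
  then show ?thesis
    using nn by (simp add: I_def ennreal_mult)
qed

text \<open>The weight is squared so that Cauchy--Schwarz can split it without a square root.\<close>

lemma nn_integral_Young:
  fixes \<gamma> w :: "'a::euclidean_space \<Rightarrow> ennreal"
  assumes [measurable]: "\<gamma> \<in> borel_measurable borel" "w \<in> borel_measurable borel"
  shows "(\<integral>\<^sup>+u. (\<integral>\<^sup>+v. \<gamma> (u + v) * (w v)\<^sup>2 \<partial>lborel)\<^sup>2 \<partial>lborel) \<le>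
    (\<integral>\<^sup>+v. (w v)\<^sup>2 \<partial>lborel)\<^sup>2 * (\<integral>\<^sup>+u. (\<gamma> u)\<^sup>2 \<partial>lborel)"
proof -
  define J where "J = (\<integral>\<^sup>+v. (w v)\<^sup>2 \<partial>lborel)"
  have "(\<integral>\<^sup>+v. \<gamma> (u + v) * (w v)\<^sup>2 \<partial>lborel)\<^sup>2 \<le>
      (\<integral>\<^sup>+v. (\<gamma> (u + v))\<^sup>2 * (w v)\<^sup>2 \<partial>lborel) * J" for u
    using Cauchy_Schwarz_nn_integral[of "\<lambda>v. \<gamma> (u + v) * w v" lborel w]
    by (simp add: J_def power_mult_distrib power2_eq_square mult_ac)
  then have "(\<integral>\<^sup>+u. (\<integral>\<^sup>+v. \<gamma> (u + v) * (w v)\<^sup>2 \<partial>lborel)\<^sup>2 \<partial>lborel) \<le>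
      (\<integral>\<^sup>+u. (\<integral>\<^sup>+v. (\<gamma> (u + v))\<^sup>2 * (w v)\<^sup>2 \<partial>lborel) * J \<partial>lborel)"
    by (intro nn_integral_mono)
  also have "\<dots> = (\<integral>\<^sup>+u. \<integral>\<^sup>+v. (\<gamma> (u + v))\<^sup>2 * (w v)\<^sup>2 \<partial>lborel \<partial>lborel) * J"
    by (rule nn_integral_multc) measurable
  \<comment> \<open>Tonelli brings the \<open>u\<close> integral inside, where translation
    invariance removes the shift by \<open>v\<close>.\<close>
  also have "(\<integral>\<^sup>+u. \<integral>\<^sup>+v. (\<gamma> (u + v))\<^sup>2 * (w v)\<^sup>2 \<partial>lborel \<partial>lborel) =
      (\<integral>\<^sup>+v. \<integral>\<^sup>+u. (\<gamma> (u + v))\<^sup>2 * (w v)\<^sup>2 \<partial>lborel \<partial>lborel)"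
    by (rule lborel_pair.Fubini') measurable
  also have "\<dots> = (\<integral>\<^sup>+v. (\<integral>\<^sup>+u. (\<gamma> u)\<^sup>2 \<partial>lborel) * (w v)\<^sup>2 \<partial>lborel)"
    using nn_integral_lborel_shift[of "\<lambda>u. (\<gamma> u)\<^sup>2"]
    by (simp add: nn_integral_multc add.commute)
  also have "\<dots> = (\<integral>\<^sup>+u. (\<gamma> u)\<^sup>2 \<partial>lborel) * J"
    unfolding J_def by (rule nn_integral_cmult) measurable
  finally show ?thesis
    by (simp add: J_def power2_eq_square mult_ac)
qed

text \<open>The elementary estimate
  \<open>cmod (exp y - 1) \<le> exp \<bar>Re y\<bar> * cmod y\<close> supplies the factor
  \<open>cmod x\<close>, and half of the Gaussian exponent absorbs the exponential growth. The
  result is an integrable convolution weight.\<close>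

lemma coherent_diff_one_bound:
  assumes x: "cmod x \<le> 1"
  shows "cmod (fock_fun (coherent x - fock_one) v) * exp (- (cmod v)\<^sup>2 / 2) \<le>
    cmod x * exp 5 * exp (- (cmod v)\<^sup>2 / 4)"
proof -
  define t where "t = cmod v"
  define y where "y = v * cnj x - of_real ((cmod x)\<^sup>2) / 2"
  have "cmod y \<le> t * cmod x + (cmod x)\<^sup>2 / 2"
    unfolding y_def t_def by (rule order_trans[OF norm_triangle_ineq4]) (simp add: norm_mult norm_divide norm_power)
  also have "(cmod x)\<^sup>2 / 2 \<le> cmod x"
    using mult_right_mono[OF x, of "cmod x"] norm_ge_zero[of x] unfolding power2_eq_square by linarith
  finally have y: "cmod y \<le> cmod x * (t + 1)"
    by (simp add: algebra_simps)
  have x1: "cmod x * (t + 1) \<le> t + 1"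
    using mult_right_mono[OF x, of "t + 1"] by (simp add: t_def)
  have y1: "\<bar>Re y\<bar> \<le> t + 1"
    by (rule order_trans[OF abs_Re_le_cmod order_trans[OF y x1]])
  have "cmod (fock_fun (coherent x - fock_one) v) = cmod (exp y - 1)"
    by (simp add: minus_fock.rep_eq fock_fun_coherent fock_one.rep_eq y_def)
  also have "\<dots> \<le> exp \<bar>Re y\<bar> * cmod y"
    using Taylor_exp[of y 0] by simp
  also have "\<dots> \<le> exp (t + 1) * (cmod x * exp t)"
    using y y1 exp_ge_add_one_self[of t] mult_left_mono[of "t + 1" "exp t" "cmod x"]
    by (intro mult_mono) (auto simp: add.commute)
  finally have "cmod (fock_fun (coherent x - fock_one) v) * exp (- t\<^sup>2 / 2) \<le>
      exp (t + 1) * (cmod x * exp t) * exp (- t\<^sup>2 / 2)"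
    by (rule mult_right_mono) simp
  also have "\<dots> = cmod x * exp (t + 1 + t - t\<^sup>2 / 2)"
    by (simp only: exp_add[symmetric] mult.left_commute[of _ "cmod x"] mult.assoc) (simp add: algebra_simps)
  also have "\<dots> \<le> cmod x * exp (5 - t\<^sup>2 / 4)"
  proof -
    \<comment> \<open>Source of the constant 5:
      \<open>2 * t + 1 - t\<^sup>2 / 2 \<le> 5 - t\<^sup>2 / 4\<close> says that this square is
      nonnegative.\<close>
    have "0 \<le> (t / 2 - 2)\<^sup>2" by simp
    then have "t + 1 + t - t\<^sup>2 / 2 \<le> 5 - t\<^sup>2 / 4"
      by (simp add: power2_diff power_divide)
    then show ?thesis by (intro mult_left_mono) auto
  qed
  also have "\<dots> = cmod x * exp 5 * exp (- t\<^sup>2 / 4)"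
    by (simp only: exp_add[symmetric] mult.assoc) simp
  finally show ?thesis by (simp add: t_def)
qed

text \<open>Evaluation at \<open>u\<close> is pairing with \<open>coherent u\<close>. With the Weyl
  operators moved across, both terms pair the same function \<open>weyl_fock (- u) g\<close>, once
  with \<open>coherent (- x)\<close> and once with 1.\<close>

lemma weyl_fun_diff_eq_cinner:
  "(weyl_fun x (fock_fun g) u - weyl_phase x u * fock_fun g u) * exp (- of_real ((cmod u)\<^sup>2) / 2) =
    weyl_phase x u * fock_cinner (weyl_fock (- u) g) (coherent (- x) - fock_one)"
proof -
  have one: "fock_one = coherent 0"
    by (rule fock_eqI) (simp add: fock_fun_coherent fock_one.rep_eq)
  have "exp (u * cnj x - x * cnj x / 2) * exp (- (u * cnj u) / 2) =
      exp (cnj x * u - x * cnj u) * (exp (- (x * cnj x) / 2) * exp (x * cnj u - u * cnj u / 2))"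
    unfolding exp_add[symmetric] by (simp add: algebra_simps)
  then show ?thesis
    unfolding one fock_cinner_diff_right fock_cinner_coherent weyl_fock.rep_eq weyl_fun_def weyl_phase_def
      complex_norm_square
    by (simp add: algebra_simps)
qed

lemma nn_integral_fock_power2:
  "(\<integral>\<^sup>+z. ennreal ((cmod (fock_fun g z))\<^sup>2) \<partial>gauss_measure) = ennreal ((norm g)\<^sup>2)"
proof -
  have "integrable gauss_measure (\<lambda>z. (cmod (fock_fun g z))\<^sup>2)"
    using fock_fun[of g] by (simp add: fock_set_def)
  then show ?thesis
    by (subst nn_integral_eq_integral) (auto simp: norm_fock_eq)
qed

lemma nn_integral_gauss_measure:
  assumes [measurable]: "f \<in> borel_measurable borel" and "\<And>z. 0 \<le> f z"
  shows "(\<integral>\<^sup>+z. ennreal (f z) \<partial>gauss_measure) =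
    ennreal (1 / pi) * (\<integral>\<^sup>+z. ennreal (f z * exp (- (cmod z)\<^sup>2)) \<partial>lborel)"
  unfolding gauss_measure_def
  by (subst nn_integral_density)
    (auto simp: nn_integral_cmult[symmetric] ennreal_mult[symmetric] assms mult.commute intro!: nn_integral_cong)

lemma weyl_fun_borel [measurable]: "weyl_fun x (fock_fun g) \<in> borel_measurable borel"
  using fock_fun_borel[of "weyl_fock x g"] by (simp add: weyl_fock.rep_eq)

lemma weyl_phase_borel [measurable]: "weyl_phase x \<in> borel_measurable borel"
  unfolding weyl_phase_def[abs_def] by (intro borel_measurable_continuous_onI continuous_intros)

text \<open>The phase is not holomorphic in \<open>u\<close>, so the comparison takes place in L^2
  and not in the Fock space. The weighted difference is dominated by a Gaussian average of
  translates of \<open>g\<close>, and Young's inequality gives a bound linear in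
  \<open>cmod x\<close>.\<close>

lemma weyl_fun_phase_L2_bound:
  assumes x: "cmod x \<le> 1"
  shows "(\<integral>\<^sup>+u. ennreal ((cmod (weyl_fun x (fock_fun g) u - weyl_phase x u * fock_fun g u))\<^sup>2) \<partial>gauss_measure)
    \<le> ennreal ((4 * exp 5 * cmod x * norm g)\<^sup>2)"
proof -
  \<comment> \<open>Multiplying by the root of the Gaussian passes to Lebesgue L^2. The weight
    \<open>w\<close> is squared in \<open>nn_integral_Young\<close>, and its square has mass
    \<open>4 * pi\<close>.\<close>
  define \<gamma> where "\<gamma> = (\<lambda>u. ennreal (cmod (fock_fun g u) * exp (- (cmod u)\<^sup>2 / 2)))"
  define w where "w = (\<lambda>v::complex. ennreal (exp (- (cmod v)\<^sup>2 / 8)))"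
  define D where "D = (\<lambda>u. cmod (weyl_fun x (fock_fun g) u - weyl_phase x u * fock_fun g u))"
  define c where "c = cmod x * exp 5 / pi"
  have c: "0 \<le> c" by (simp add: c_def)
  have [measurable]: "\<gamma> \<in> borel_measurable borel" "w \<in> borel_measurable borel" "D \<in> borel_measurable borel"
    unfolding \<gamma>_def w_def D_def by measurable
  have w2: "(w v)\<^sup>2 = ennreal (exp (- (1 / 4) * (cmod v)\<^sup>2))" for v
    by (simp add: w_def ennreal_power exp_double[symmetric])
  have \<gamma>: "(\<integral>\<^sup>+u. (\<gamma> u)\<^sup>2 \<partial>lborel) = ennreal (pi * (norm g)\<^sup>2)"
  proof -
    have e: "(\<gamma> u)\<^sup>2 = ennreal ((cmod (fock_fun g u))\<^sup>2 * exp (- (cmod u)\<^sup>2))" for u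
      by (simp add: \<gamma>_def ennreal_power power_mult_distrib exp_of_nat_mult[symmetric])
    have "ennreal pi * ennreal ((norm g)\<^sup>2) = ennreal pi * (ennreal (1 / pi) * (\<integral>\<^sup>+u. (\<gamma> u)\<^sup>2 \<partial>lborel))"
      unfolding e nn_integral_fock_power2[symmetric] by (subst nn_integral_gauss_measure) auto
    then show ?thesis
      by (simp add: mult.assoc[symmetric] ennreal_mult[symmetric])
  qed
  have pt: "ennreal (D u * exp (- (cmod u)\<^sup>2 / 2)) \<le> ennreal c * (\<integral>\<^sup>+v. \<gamma> (u + v) * (w v)\<^sup>2 \<partial>lborel)" for u
  proof -
    let ?G = "weyl_fock (- u) g" and ?k = "coherent (- x) - fock_one"
    \<comment> \<open>With the root of the Gaussian attached, the modulus of a Weyl translate is a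
      plain translate; this makes the inner product a convolution-type integral.\<close>
    have G: "cmod (fock_fun ?G v) * exp (- (cmod v)\<^sup>2 / 2) = cmod (fock_fun g (u + v)) * exp (- (cmod (u + v))\<^sup>2 / 2)" for v
    proof -
      have "Re (- v * cnj u) - (cmod u)\<^sup>2 / 2 - (cmod v)\<^sup>2 / 2 = - (cmod (u + v))\<^sup>2 / 2"
        by (simp only: cmod_power2) (simp add: power2_eq_square field_simps)
      then have "exp (Re (- v * cnj u) - (cmod u)\<^sup>2 / 2) * exp (- (cmod v)\<^sup>2 / 2) = exp (- (cmod (u + v))\<^sup>2 / 2)"
        by (simp only: exp_add[symmetric]) simp
      moreover have "cmod (fock_fun ?G v) = exp (Re (- v * cnj u) - (cmod u)\<^sup>2 / 2) * cmod (fock_fun g (u + v))"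
        by (simp add: weyl_fock.rep_eq weyl_fun_def norm_mult add.commute)
      ultimately show ?thesis by (simp add: mult_ac)
    qed
    have "D u * exp (- (cmod u)\<^sup>2 / 2) = cmod (fock_cinner ?G ?k)"
    proof -
      have "D u * exp (- (cmod u)\<^sup>2 / 2) =
          cmod ((weyl_fun x (fock_fun g) u - weyl_phase x u * fock_fun g u) * exp (- of_real ((cmod u)\<^sup>2) / 2))"
        by (simp add: D_def norm_mult)
      then show ?thesis
        unfolding weyl_fun_diff_eq_cinner by (simp add: norm_mult)
    qed
    then have "ennreal (D u * exp (- (cmod u)\<^sup>2 / 2)) \<le>
        (\<integral>\<^sup>+v. ennreal (cmod (fock_fun ?G v) * cmod (fock_fun ?k v)) \<partial>gauss_measure)"
      using integral_norm_bound_ennreal[OF fock_integrable[of ?G ?k]]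
      by (simp add: fock_cinner_def norm_mult)
    also have "\<dots> = ennreal (1 / pi) *
        (\<integral>\<^sup>+v. ennreal (cmod (fock_fun ?G v) * cmod (fock_fun ?k v) * exp (- (cmod v)\<^sup>2)) \<partial>lborel)"
      by (rule nn_integral_gauss_measure) auto
    also have "(\<integral>\<^sup>+v. ennreal (cmod (fock_fun ?G v) * cmod (fock_fun ?k v) * exp (- (cmod v)\<^sup>2)) \<partial>lborel) \<le>
        (\<integral>\<^sup>+v. ennreal (cmod x * exp 5) * (\<gamma> (u + v) * (w v)\<^sup>2) \<partial>lborel)"
    proof (rule nn_integral_mono)
      fix v
      have "exp (- (cmod v)\<^sup>2) = exp (- (cmod v)\<^sup>2 / 2) * exp (- (cmod v)\<^sup>2 / 2)"
        by (simp add: exp_add[symmetric])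
      then have "cmod (fock_fun ?G v) * cmod (fock_fun ?k v) * exp (- (cmod v)\<^sup>2) =
          (cmod (fock_fun ?G v) * exp (- (cmod v)\<^sup>2 / 2)) * (cmod (fock_fun ?k v) * exp (- (cmod v)\<^sup>2 / 2))"
        by (simp add: mult_ac)
      also have "\<dots> \<le> (cmod (fock_fun g (u + v)) * exp (- (cmod (u + v))\<^sup>2 / 2)) *
          (cmod x * exp 5 * exp (- (cmod v)\<^sup>2 / 4))"
        unfolding G using coherent_diff_one_bound[of "- x" v] x by (intro mult_left_mono) auto
      also have "ennreal \<dots> = ennreal (cmod x * exp 5) * (\<gamma> (u + v) * (w v)\<^sup>2)"
        unfolding w2 \<gamma>_def by (simp add: ennreal_mult[symmetric] mult_ac)
      finally show "ennreal (cmod (fock_fun ?G v) * cmod (fock_fun ?k v) * exp (- (cmod v)\<^sup>2)) \<le>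
          ennreal (cmod x * exp 5) * (\<gamma> (u + v) * (w v)\<^sup>2)"
        by (simp add: ennreal_leI)
    qed
    also have "\<dots> = ennreal (cmod x * exp 5) * (\<integral>\<^sup>+v. \<gamma> (u + v) * (w v)\<^sup>2 \<partial>lborel)"
      by (rule nn_integral_cmult) measurable
    finally show ?thesis
      by (simp add: c_def mult_left_mono mult.assoc[symmetric] ennreal_mult[symmetric])
  qed
  have "(\<integral>\<^sup>+u. ennreal ((D u)\<^sup>2) \<partial>gauss_measure) =
      ennreal (1 / pi) * (\<integral>\<^sup>+u. (ennreal (D u * exp (- (cmod u)\<^sup>2 / 2)))\<^sup>2 \<partial>lborel)"
    by (subst nn_integral_gauss_measure)
      (auto simp: D_def ennreal_power power_mult_distrib exp_of_nat_mult[symmetric])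
  also have "\<dots> \<le> ennreal (1 / pi) *
      (\<integral>\<^sup>+u. ennreal (c\<^sup>2) * (\<integral>\<^sup>+v. \<gamma> (u + v) * (w v)\<^sup>2 \<partial>lborel)\<^sup>2 \<partial>lborel)"
    using power_mono[OF pt, where n = 2] c
    by (intro mult_left_mono nn_integral_mono) (auto simp: power_mult_distrib ennreal_power)
  also have "\<dots> = ennreal (1 / pi) * (ennreal (c\<^sup>2) *
      (\<integral>\<^sup>+u. (\<integral>\<^sup>+v. \<gamma> (u + v) * (w v)\<^sup>2 \<partial>lborel)\<^sup>2 \<partial>lborel))"
    by (subst nn_integral_cmult) auto
  also have "\<dots> \<le> ennreal (1 / pi) * (ennreal (c\<^sup>2) *
      ((\<integral>\<^sup>+v. (w v)\<^sup>2 \<partial>lborel)\<^sup>2 * (\<integral>\<^sup>+u. (\<gamma> u)\<^sup>2 \<partial>lborel)))"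
    by (intro mult_left_mono nn_integral_Young) auto
  also have "\<dots> = ennreal (1 / pi) * (ennreal (c\<^sup>2) * ((ennreal (4 * pi))\<^sup>2 * ennreal (pi * (norm g)\<^sup>2)))"
    using nn_integral_gaussian_complex[of "1 / 4"] by (simp only: w2 \<gamma>) (simp add: mult.commute)
  also have "\<dots> = ennreal (1 / pi * (c\<^sup>2 * ((4 * pi)\<^sup>2 * (pi * (norm g)\<^sup>2))))"
    unfolding ennreal_power[of "4 * pi" 2, OF mult_nonneg_nonneg[OF zero_le_numeral pi_ge_zero]]
    by (subst ennreal_mult[symmetric], simp, simp)+ (rule refl)
  also have "1 / pi * (c\<^sup>2 * ((4 * pi)\<^sup>2 * (pi * (norm g)\<^sup>2))) = (4 * exp 5 * cmod x * norm g)\<^sup>2"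
    by (simp add: c_def power2_eq_square field_simps)
  finally show ?thesis
    by (simp add: D_def)
qed

section \<open>The distance estimate\<close>

lemma
  assumes f [measurable]: "f \<in> borel_measurable borel"
    and C: "AE z in lborel. cmod (f z) \<le> C"
  shows AE_gauss_measure_bounded: "AE z in gauss_measure. cmod (f z) \<le> C"
    and integrable_bounded_fock_product:
      "integrable gauss_measure (\<lambda>z. f z * (fock_fun g z * cnj (fock_fun k z)))"
proof -
  show C': "AE z in gauss_measure. cmod (f z) \<le> C"
    unfolding gauss_measure_def using C by (subst AE_density) auto
  have [measurable]: "cnj \<in> borel_measurable borel"
    by (intro borel_measurable_continuous_onI continuous_intros)
  show "integrable gauss_measure (\<lambda>z. f z * (fock_fun g z * cnj (fock_fun k z)))"
  proof (rule Bochner_Integration.integrable_bound)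
    show "integrable gauss_measure (\<lambda>z. C *\<^sub>R (fock_fun g z * cnj (fock_fun k z)))"
      by (intro integrable_scaleR_right fock_integrable)
    show "AE z in gauss_measure. norm (f z * (fock_fun g z * cnj (fock_fun k z))) \<le>
        norm (C *\<^sub>R (fock_fun g z * cnj (fock_fun k z)))"
      using C'
    proof eventually_elim
      case (elim z)
      then have "cmod (f z) \<le> \<bar>C\<bar>" by simp
      then show ?case by (simp add: norm_mult mult_right_mono)
    qed
  qed measurable
qed

text \<open>The defect of the projection is orthogonal to every \<open>k\<close>. Essential
  boundedness of \<open>f\<close> provides the integrability needed to split that integral.\<close>

lemma fock_cinner_toeplitz:
  assumes f: "f \<in> borel_measurable borel" and C: "AE z in lborel. cmod (f z) \<le> C"
    and T: "is_toeplitz f T"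
  shows "fock_cinner (blinfun_apply T g) k =
      (LINT z|gauss_measure. f z * (fock_fun g z * cnj (fock_fun k z)))"
proof -
  have "0 = (LINT z|gauss_measure. (f z * fock_fun g z - fock_fun (blinfun_apply T g) z) * cnj (fock_fun k z))"
    using T by (simp add: is_toeplitz_def is_fock_projection_def)
  also have "\<dots> = (LINT z|gauss_measure. f z * (fock_fun g z * cnj (fock_fun k z)) -
      fock_fun (blinfun_apply T g) z * cnj (fock_fun k z))"
    by (simp add: algebra_simps)
  also have "\<dots> = (LINT z|gauss_measure. f z * (fock_fun g z * cnj (fock_fun k z))) -
      fock_cinner (blinfun_apply T g) k"
    unfolding fock_cinner_def
    by (intro Bochner_Integration.integral_diff integrable_bounded_fock_product[OF f C] fock_integrable)
  finally show ?thesis by simp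
qed

text \<open>Complex linearity is read off from the integral formula, which is complex linear in
  \<open>g\<close>.\<close>

lemma is_toeplitz_fock_operators:
  assumes f: "f \<in> borel_measurable borel" and C: "AE z in lborel. cmod (f z) \<le> C"
    and T: "is_toeplitz f T"
  shows "T \<in> fock_operators"
  unfolding fock_operators_def
proof (intro CollectI allI fock_eq_by_cinner)
  fix c g k
  have "(LINT z|gauss_measure. f z * (c * fock_fun g z * cnj (fock_fun k z))) =
      (LINT z|gauss_measure. c * (f z * (fock_fun g z * cnj (fock_fun k z))))"
    by (simp add: mult_ac)
  then show "fock_cinner (blinfun_apply T (fock_scaleC c g)) k =
      fock_cinner (fock_scaleC c (blinfun_apply T g)) k"
    by (simp add: fock_cinner_scaleC_left fock_cinner_toeplitz[OF f C T] fock_scaleC.rep_eq)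
qed

text \<open>In the form of the commutator both Weyl translates are replaced by phase multiples. Each
  replacement costs \<open>C * K\<close>, which gives \<open>2 * C * K\<close> in total.\<close>

lemma toeplitz_commutator_bound:
  assumes f [measurable]: "f \<in> borel_measurable borel"
    and C: "AE z in lborel. cmod (f z) \<le> C" "0 \<le> C"
    and T: "is_toeplitz f T" and x: "cmod x \<le> 1"
  shows "norm (weyl_comm x T) \<le> 8 * exp 5 * C * cmod x"
proof -
  define K where "K = 4 * exp 5 * cmod x"
  have K: "0 \<le> K" by (simp add: K_def)
  note C' = AE_gauss_measure_bounded[OF f C(1)]
    and int = integrable_bounded_fock_product[OF f C(1)]
    and T_eq = fock_cinner_toeplitz[OF f C(1) T]
  have bound: "cmod (fock_cinner (blinfun_apply (weyl_comm x T) g) h) \<le> 2 * C * K * norm g * norm h" for g h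
  proof -
    define a b where "a = (\<lambda>u. weyl_fun x (fock_fun g) u - weyl_phase x u * fock_fun g u)"
      and "b = (\<lambda>u. weyl_fun (- x) (fock_fun h) u - weyl_phase (- x) u * fock_fun h u)"
    have [measurable]: "a \<in> borel_measurable borel" "b \<in> borel_measurable borel"
      unfolding a_def b_def by measurable
    have a: "(\<integral>\<^sup>+u. ennreal ((cmod (a u))\<^sup>2) \<partial>gauss_measure) \<le> ennreal ((K * norm g)\<^sup>2)"
      and b: "(\<integral>\<^sup>+u. ennreal ((cmod (b u))\<^sup>2) \<partial>gauss_measure) \<le> ennreal ((K * norm h)\<^sup>2)"
      using weyl_fun_phase_L2_bound[of x g] weyl_fun_phase_L2_bound[of "- x" h] x
      by (simp_all add: a_def b_def K_def)
    define F where "F = (\<lambda>u. f u * (fock_fun g u * cnj (fock_fun (weyl_fock (- x) h) u)) -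
        f u * (fock_fun (weyl_fock x g) u * cnj (fock_fun h u)))"
    \<comment> \<open>The phase terms cancel because the conjugate of
      \<open>weyl_phase (- x) u\<close> is \<open>weyl_phase x u\<close>; only the errors
      \<open>a\<close> and \<open>b\<close> survive.\<close>
    have F: "F u = f u * (fock_fun g u * cnj (b u) - a u * cnj (fock_fun h u))" for u
      by (simp add: F_def a_def b_def weyl_fock.rep_eq weyl_phase_uminus algebra_simps)
    have intF: "integrable gauss_measure F"
      unfolding F_def by (intro Bochner_Integration.integrable_diff int)
    have "fock_cinner (blinfun_apply (weyl_comm x T) g) h = (LINT u|gauss_measure. F u)"
      unfolding F_def
      by (subst Bochner_Integration.integral_diff[OF int int])
        (simp add: weyl_comm_apply fock_cinner_diff_left weyl_fock_adjoint T_eq)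
    then have "ennreal (cmod (fock_cinner (blinfun_apply (weyl_comm x T) g) h)) \<le>
        (\<integral>\<^sup>+u. ennreal (cmod (F u)) \<partial>gauss_measure)"
      using integral_norm_bound_ennreal[OF intF] by simp
    also have "\<dots> \<le> (\<integral>\<^sup>+u. ennreal C * (ennreal (cmod (fock_fun g u) * cmod (b u)) +
        ennreal (cmod (a u) * cmod (fock_fun h u))) \<partial>gauss_measure)"
    proof (rule nn_integral_mono_AE)
      show "AE u in gauss_measure. ennreal (cmod (F u)) \<le> ennreal C *
          (ennreal (cmod (fock_fun g u) * cmod (b u)) + ennreal (cmod (a u) * cmod (fock_fun h u)))"
        using C'
      proof eventually_elim
        case (elim u)
        have "cmod (fock_fun g u * cnj (b u) - a u * cnj (fock_fun h u)) \<le>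
            cmod (fock_fun g u) * cmod (b u) + cmod (a u) * cmod (fock_fun h u)"
          by (rule order_trans[OF norm_triangle_ineq4]) (simp add: norm_mult)
        then have "cmod (F u) \<le> C * (cmod (fock_fun g u) * cmod (b u) + cmod (a u) * cmod (fock_fun h u))"
          unfolding F norm_mult[of "f u"] using elim C by (intro mult_mono) auto
        then have "ennreal (cmod (F u)) \<le>
            ennreal (C * (cmod (fock_fun g u) * cmod (b u) + cmod (a u) * cmod (fock_fun h u)))"
          by (rule ennreal_leI)
        then show ?case
          using C(2) by (simp add: ennreal_mult)
      qed
    qed
    also have "\<dots> = ennreal C * ((\<integral>\<^sup>+u. ennreal (cmod (fock_fun g u) * cmod (b u)) \<partial>gauss_measure) +
        (\<integral>\<^sup>+u. ennreal (cmod (a u) * cmod (fock_fun h u)) \<partial>gauss_measure))"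
      by (subst nn_integral_cmult, measurable, subst nn_integral_add, measurable)
    also have "\<dots> \<le> ennreal C * (ennreal (norm g * (K * norm h)) + ennreal ((K * norm g) * norm h))"
      using a b K nn_integral_fock_power2[of g] nn_integral_fock_power2[of h]
      by (intro mult_left_mono add_mono nn_integral_mult_le_of_squares) auto
    also have "\<dots> = ennreal (C * (norm g * (K * norm h) + (K * norm g) * norm h))"
      using C(2) K by (simp only: ennreal_plus[symmetric] ennreal_mult[symmetric] norm_ge_zero
          mult_nonneg_nonneg add_nonneg_nonneg)
    also have "C * (norm g * (K * norm h) + (K * norm g) * norm h) = 2 * C * K * norm g * norm h"
      by (simp add: algebra_simps)
    finally show ?thesis
      using C(2) K by (subst (asm) ennreal_le_iff) auto
  qed
  have "norm (weyl_comm x T) \<le> 2 * C * K"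
  proof (rule norm_blinfun_bound)
    show "0 \<le> 2 * C * K" using C K by simp
    fix g
    \<comment> \<open>Testing the form against the image vector itself recovers the operator
      norm.\<close>
    let ?h = "blinfun_apply (weyl_comm x T) g"
    have "norm ?h * norm ?h = cmod (fock_cinner ?h ?h)"
      unfolding norm_fock_power2[symmetric] by (simp add: power2_eq_square norm_mult)
    also have "\<dots> \<le> (2 * C * K * norm g) * norm ?h"
      by (rule bound)
    finally show "norm ?h \<le> 2 * C * K * norm g"
      using C K by (cases "?h = 0") (auto dest: mult_right_le_imp_le)
  qed
  then show ?thesis by (simp add: K_def mult_ac)
qed

lemma is_toeplitz_weyl_continuous:
  assumes "f \<in> L_infinity" and T: "is_toeplitz f T"
  shows "T \<in> weyl_continuous"
proof -
  obtain C0 where f: "f \<in> borel_measurable borel" and C0: "AE z in lborel. cmod (f z) \<le> C0"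
    using assms by (auto simp: L_infinity_def)
  define C where "C = max 0 C0"
  have C: "AE z in lborel. cmod (f z) \<le> C" "0 \<le> C"
    using C0 by (auto simp: C_def elim!: eventually_mono)
  have "((\<lambda>x. weyl_comm x T) \<longlongrightarrow> 0) (at 0)"
  proof (rule Lim_null_comparison)
    show "\<forall>\<^sub>F x in at 0. norm (weyl_comm x T) \<le> 8 * exp 5 * C * cmod x"
      using toeplitz_commutator_bound[OF f C T] unfolding eventually_at
      by (intro exI[of _ 1]) auto
    have "((\<lambda>x. 8 * exp 5 * C * cmod x) \<longlongrightarrow> 8 * exp 5 * C * cmod 0) (at 0)"
      by (intro tendsto_intros)
    then show "((\<lambda>x. 8 * exp 5 * C * cmod x) \<longlongrightarrow> 0) (at 0)" by simp
  qed
  then show ?thesis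
    using is_toeplitz_fock_operators[OF f C(1) T] by (simp add: weyl_continuous_def)
qed

section \<open>The Toeplitz algebra and the limsup bound\<close>

lemma toeplitz_algebra_subset: "toeplitz_algebra \<subseteq> weyl_continuous"
  unfolding toeplitz_algebra_def C_star_generated_def
  by (rule Inter_lower) (auto intro: C_star_subalgebra_weyl_continuous is_toeplitz_weyl_continuous)

text \<open>Keeps the infimum over a nonempty set; as an approximant, 0 also shows that the limsup
  is not infinite.\<close>

lemma zero_in_toeplitz_algebra: "0 \<in> toeplitz_algebra"
  by (auto simp: toeplitz_algebra_def C_star_generated_def C_star_subalgebra_def)

text \<open>Pairing with \<open>coherent z\<close> evaluates at \<open>z\<close>, where the
  composition evaluates the kernel of \<open>\<phi> z\<close> at its own centre; this gives the
  factor \<open>exp ((cmod (\<phi> z))\<^sup>2 / 2)\<close>.\<close>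

lemma M_fun_eq_weighted_comp_coherent:
  assumes "is_weighted_comp_op \<psi> \<phi> W"
  shows "M_fun (fock_fun \<psi>) \<phi> z =
    (cmod (fock_cinner (blinfun_apply W (coherent (\<phi> z))) (coherent z)))\<^sup>2"
proof -
  let ?p = "\<phi> z"
  have "fock_cinner (blinfun_apply W (coherent ?p)) (coherent z) =
      exp (- of_real ((cmod z)\<^sup>2) / 2) * (fock_fun \<psi> z * exp (?p * cnj ?p - of_real ((cmod ?p)\<^sup>2) / 2))"
    using assms by (simp add: fock_cinner_coherent is_weighted_comp_op_def weighted_comp_def fock_fun_coherent)
  also have "?p * cnj ?p - of_real ((cmod ?p)\<^sup>2) / 2 = of_real ((cmod ?p)\<^sup>2 / 2)"
    by (simp add: complex_norm_square del: of_real_power)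
  finally have "cmod (fock_cinner (blinfun_apply W (coherent ?p)) (coherent z)) =
      exp (- (cmod z)\<^sup>2 / 2) * (cmod (fock_fun \<psi> z) * exp ((cmod ?p)\<^sup>2 / 2))"
    by (simp add: norm_mult)
  moreover have "(exp (t / 2))\<^sup>2 = exp t" for t :: real
    by (simp add: exp_double[symmetric])
  ultimately show ?thesis
    by (simp only: M_fun_def power_mult_distrib diff_conv_add_uminus exp_add mult_ac)
qed

lemma Limsup_M_fun_le:
  fixes a lam :: complex
  assumes lam: "lam \<noteq> 1" and \<phi>: "\<phi> = (\<lambda>w. a + lam * w)"
    and W: "is_weighted_comp_op \<psi> \<phi> W" and A: "A \<in> weyl_continuous"
  shows "Limsup at_infinity (\<lambda>z. ereal (M_fun (fock_fun \<psi>) \<phi> z)) \<le> ereal (norm W * norm (W - A))"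
proof -
  define q where "q = (\<lambda>z. cmod (fock_cinner (blinfun_apply A (coherent (\<phi> z))) (coherent z)))"
  \<comment> \<open>The difference is affine in \<open>z\<close> with slope \<open>1 - lam\<close>,
    which is nonzero.\<close>
  have "filterlim (\<lambda>z. z - \<phi> z) at_infinity at_infinity"
  proof -
    have "filterlim (\<lambda>z. - a + (1 - lam) * z) at_infinity at_infinity"
      using lam by (intro tendsto_add_filterlim_at_infinity[OF tendsto_const]
          tendsto_mult_filterlim_at_infinity[OF tendsto_const] filterlim_ident) auto
    then show ?thesis by (simp add: \<phi> algebra_simps)
  qed
  then have "(q \<longlongrightarrow> 0) at_infinity"
    unfolding q_def by (intro tendsto_norm_zero weyl_continuous_coherent_tendsto_0[OF A])
  then have "((\<lambda>z. norm W * (norm (W - A) + q z)) \<longlongrightarrow> norm W * (norm (W - A) + 0)) at_infinity"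
    by (intro tendsto_intros)
  then have "Limsup at_infinity (\<lambda>z. ereal (norm W * (norm (W - A) + q z))) = ereal (norm W * norm (W - A))"
    by (intro lim_imp_Limsup trivial_limit_at_infinity) simp
  moreover have "M_fun (fock_fun \<psi>) \<phi> z \<le> norm W * (norm (W - A) + q z)" for z
  proof -
    let ?b = "\<lambda>B. fock_cinner (blinfun_apply B (coherent (\<phi> z))) (coherent z)"
    have le: "cmod (?b B) \<le> norm B" for B
    proof -
      have "cmod (?b B) \<le> norm (blinfun_apply B (coherent (\<phi> z))) * norm (coherent z)"
        by (rule cmod_fock_cinner_le)
      also have "\<dots> \<le> norm B"
        using norm_blinfun[of B "coherent (\<phi> z)"] by simp
      finally show ?thesis .
    qed
    have "?b W = ?b (W - A) + ?b A"
      by (simp add: blinfun.diff_left fock_cinner_diff_left)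
    then have "cmod (?b W) \<le> cmod (?b (W - A)) + q z"
      unfolding q_def by (metis norm_triangle_ineq)
    also have "\<dots> \<le> norm (W - A) + q z"
      by (intro add_right_mono le)
    \<comment> \<open>Only one of the two factors is bounded by \<open>norm W\<close>, so the
      estimate stays linear in the distance to \<open>A\<close>.\<close>
    finally have "cmod (?b W) * cmod (?b W) \<le> norm W * (norm (W - A) + q z)"
      by (intro mult_mono le) auto
    then show ?thesis
      by (simp add: M_fun_eq_weighted_comp_coherent[OF W] power2_eq_square)
  qed
  then have "Limsup at_infinity (\<lambda>z. ereal (M_fun (fock_fun \<psi>) \<phi> z)) \<le>
      Limsup at_infinity (\<lambda>z. ereal (norm W * (norm (W - A) + q z)))"
    by (intro Limsup_mono) simp
  ultimately show ?thesis by simp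
qed

theorem theorem3p9:
  fixes a lam :: complex and \<phi> :: "complex \<Rightarrow> complex" and \<psi> :: fock
    and W :: "fock \<Rightarrow>\<^sub>L fock"
  assumes "cmod lam \<le> 1" and "lam \<noteq> 1"
    and "\<phi> = (\<lambda>w. a + lam * w)"
    and "is_weighted_comp_op \<psi> \<phi> W"
    and "W \<noteq> 0"
  shows "ereal (INF A\<in>toeplitz_algebra. norm (W - A)) \<ge>
    ereal (1 / norm W) * Limsup at_infinity (\<lambda>z. ereal (M_fun (fock_fun \<psi>) \<phi> z))"
proof -
  define L where "L = Limsup at_infinity (\<lambda>z. ereal (M_fun (fock_fun \<psi>) \<phi> z))"
  have W: "norm W > 0" using assms by simp
  have le: "L \<le> ereal (norm W * norm (W - A))" if "A \<in> toeplitz_algebra" for A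
    unfolding L_def using that toeplitz_algebra_subset assms by (intro Limsup_M_fun_le) auto
  have "ereal (1 / norm W) * L \<le> ereal (INF A\<in>toeplitz_algebra. norm (W - A))"
  \<comment> \<open>\<open>L\<close> is an extended real: the approximant 0 excludes plus infinity,
    and for minus infinity the inequality is trivial.\<close>
  proof (cases L)
    case (real r)
    have "r / norm W \<le> (INF A\<in>toeplitz_algebra. norm (W - A))"
    proof (rule cINF_greatest)
      show "toeplitz_algebra \<noteq> {}" using zero_in_toeplitz_algebra by auto
      show "r / norm W \<le> norm (W - A)" if "A \<in> toeplitz_algebra" for A
        using le[OF that] W real by (simp add: divide_le_eq mult.commute)
    qed
    then show ?thesis using real by simp
  next
    case PInf
    then show ?thesis using le[OF zero_in_toeplitz_algebra] by simp
  next
    case MInf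
    then show ?thesis using W by simp
  qed
  then show ?thesis by (simp add: L_def)
qed

end
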